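(* Let $R$ be a polynomial of degree $N\ge 2$ with $R(0)=0$, $c=R'(0)>1$, and Julia set $\mathcal J_R\subset[0,\infty)$. Let $d_R=\frac{2\log N}{\log c}$ and let $z_0\in I_0$ (the interval $I_0$ is defined in the context). Then for every $s\in\mathbb C$ with $\operatorname{Re}(s)>d_R$ the limit $$\zeta_{R,z_0}(s)=\lim_{n\to\infty}\ \sum_{z\in R^{-n}\{z_0\}\setminus\{0\}}(c^n z)^{-s/2}$$ exists, and $\zeta_{R,z_0}$ is an analytic function of $s$ on the half plane $\operatorname{Re}(s)>d_R$. Moreover, there is a nondecreasing unbounded sequence of positive real numbers $(\lambda_j)_{j\ge1}$, determined by $R$ and $z_0$ only, such that $$\zeta_{R,z_0}(s)=\sum_{j=1}^\infty\lambda_j^{-s/2}\qquad\text{for all } s \text{ with } \operatorname{Re}(s)>d_R .$$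
   Context: Under the assumptions on $R$, its coefficients are real. Let $I$ be the convex hull of $\mathcal J_R$, a compact interval with left endpoint $0$. There is a unique decomposition $I=\bigcup_{j=1}^N I_j$ into $N$ closed intervals with disjoint interiors such that $R$ is monotone on each $I_j$. Put $I_0=\bigcap_{j=1}^N R(I_j)$; one has $R^{-1}(I_0)\subseteq I\subseteq I_0\subset[0,\infty)$. Here $R^{-n}\{z_0\}$ denotes the $N^n$ preimages of $z_0$ under the $n$-th iterate $R\circ\cdots\circ R$, counted with multiplicity (all of them are real and nonnegative for $z_0\in I_0$). The term $z=0$, if it occurs, is omitted from the sum. For $x>0$, $x^{-s/2}=\exp(-\tfrac s2\log x)$. *)

theory Defs
  imports "HOL-Complex_Analysis.Complex_Analysis"
    "HOL-Computational_Algebra.Computational_Algebra"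
begin

(* Normality in the extended (Montel) sense: locally uniform convergence to infinity
   is allowed.  This is the classical notion for holomorphic functions on a domain and
   agrees there with normality with respect to the spherical metric. *)
definition normal_family_on :: "(complex \<Rightarrow> complex) set \<Rightarrow> complex set \<Rightarrow> bool" where
  "normal_family_on F U \<longleftrightarrow>
     (\<forall>f :: nat \<Rightarrow> complex \<Rightarrow> complex. range f \<subseteq> F \<longrightarrow>
        (\<exists>r :: nat \<Rightarrow> nat. strict_mono r \<and>
           ((\<exists>g. \<forall>K. compact K \<and> K \<subseteq> U \<longrightarrow>
                uniform_limit K (\<lambda>n. f (r n)) g sequentially) \<or>
            (\<forall>K. compact K \<and> K \<subseteq> U \<longrightarrow>
                (\<forall>B. \<forall>\<^sub>F n in sequentially. \<forall>z\<in>K. B \<le> norm (f (r n) z))))))"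

definition fatou_set :: "complex poly \<Rightarrow> complex set" where
  "fatou_set R = {z. \<exists>U. open U \<and> connected U \<and> z \<in> U \<and>
                       normal_family_on (range (\<lambda>n. poly R ^^ n)) U}"

(* For a polynomial of degree at least 2 the point at infinity of the Riemann sphere
   lies in the Fatou set, so nothing is lost by taking the complement in the plane. *)
definition julia_set :: "complex poly \<Rightarrow> complex set" where
  "julia_set R = - fatou_set R"

(* The interval I.  The Julia set is pulled back to the real line; in the intended
   situation it is contained in the nonnegative real axis. *)
definition julia_hull :: "complex poly \<Rightarrow> real set" where
  "julia_hull R = convex hull (complex_of_real -` julia_set R)"

(* R as a map of the real line; in the intended situation R has real coefficients. *)
definition real_map :: "complex poly \<Rightarrow> real \<Rightarrow> real" where
  "real_map R x = Re (poly R (complex_of_real x))"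

definition is_lap_decomposition :: "complex poly \<Rightarrow> real set set \<Rightarrow> bool" where
  "is_lap_decomposition R D \<longleftrightarrow>
     finite D \<and> card D = degree R \<and> \<Union>D = julia_hull R \<and>
     (\<forall>J\<in>D. \<exists>a b. a < b \<and> J = {a..b}) \<and>
     pairwise (\<lambda>J J'. interior J \<inter> interior J' = {}) D \<and>
     (\<forall>J\<in>D. mono_on J (real_map R) \<or> antimono_on J (real_map R))"

(* In the intended situation there is exactly one lap decomposition {I_1, ..., I_N}. *)
definition lap_decomposition :: "complex poly \<Rightarrow> real set set" where
  "lap_decomposition R = (THE D. is_lap_decomposition R D)"

(* The interval I_0. *)
definition base_interval :: "complex poly \<Rightarrow> real set" where
  "base_interval R = (\<Inter>J\<in>lap_decomposition R. real_map R ` J)"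

definition iter_poly :: "complex poly \<Rightarrow> nat \<Rightarrow> complex poly" where
  "iter_poly R n = (pcompose R ^^ n) [:0, 1:]"

(* Preimages of z0 under the n-th iterate, counted with multiplicity. *)
definition preimages :: "complex poly \<Rightarrow> nat \<Rightarrow> complex \<Rightarrow> complex multiset" where
  "preimages R n z0 = proots (iter_poly R n - [:z0:])"

(* powr is the principal branch; at positive reals it is exp (- s / 2 * ln x). *)
definition zeta_partial :: "complex poly \<Rightarrow> real \<Rightarrow> nat \<Rightarrow> complex \<Rightarrow> complex" where
  "zeta_partial R z0 n s =
     (\<Sum>z\<in>#filter_mset (\<lambda>z. z \<noteq> 0) (preimages R n (of_real z0)).
        (poly (pderiv R) 0 ^ n * z) powr (- s / 2))"

definition zeta_fun :: "complex poly \<Rightarrow> real \<Rightarrow> complex \<Rightarrow> complex" where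
  "zeta_fun R z0 s = lim (\<lambda>n. zeta_partial R z0 n s)"

end

theory Submission
  imports Defs
begin

text \<open>
  The Julia set contains the repelling fixed point \<open>0\<close> and is compact and backward invariant, so its hull is
  \<open>{0..b}\<close> and all roots of \<open>R\<close> and of \<open>R - b\<close> are real and lie in \<open>{0..b}\<close>.
  Laguerre's inequality \<open>f'' f < f'\<^sup>2\<close> for the real-rooted polynomials \<open>R\<close> and \<open>R - b\<close> forces the critical
  points to be simple, with critical values outside \<open>{0<..<b}\<close>. Hence the \<open>N - 1\<close> critical points cut the hull into
  \<open>N\<close> laps, each mapped onto a superset of the hull, and every \<open>w \<in> I\<^sub>0\<close> has one preimage \<open>\<phi> w\<close> in the first lap
  and \<open>N - 1\<close> further ones which stay away from \<open>0\<close>.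

  On the first lap \<open>R x / x\<close> decreases from \<open>c\<close> to a value greater than \<open>1\<close>. So \<open>c\<^sup>m \<phi>\<^sup>m(w)\<close> increases in \<open>m\<close> to a
  finite limit. Sorting the preimages of order \<open>n\<close> by the generation \<open>k\<close> after which only \<open>\<phi>\<close> was applied, the
  \<open>k\<close>-th part of the sum is dominated by a multiple of \<open>(N c\<^sup>-\<^sup>\<sigma>\<^sup>/\<^sup>2)\<^sup>k\<close>, \<open>\<sigma> = Re s\<close>, which is summable exactly when \<open>\<sigma> > d\<close>.
  The \<open>\<lambda>\<^sub>j\<close> are the limits so obtained, in increasing order.
\<close>

section \<open>The Julia set\<close>

lemma open_fatou_set: "open (fatou_set R)"
proof -
  have "fatou_set R = \<Union>{U. open U \<and> connected U \<and> normal_family_on (range (\<lambda>n. poly R ^^ n)) U}"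
    unfolding fatou_set_def by blast
  then show ?thesis by auto
qed

text \<open>Composing with \<open>R\<close> turns iterates into iterates, so a subsequence that
  behaves well on a closed disc around \<open>z\<close> behaves equally well on the image of that
  disc. The open mapping theorem makes the image of the open disc a neighbourhood of
  \<open>poly R z\<close>.\<close>

lemma poly_image_fatou_set:
  assumes "degree R > 0" and "z \<in> fatou_set R"
  shows "poly R z \<in> fatou_set R"
proof -
  obtain U where U: "open U" "z \<in> U" and nf: "normal_family_on (range (\<lambda>n. poly R ^^ n)) U"
    using assms(2) unfolding fatou_set_def by blast
  obtain r where r: "r > 0" "cball z r \<subseteq> U" using U open_contains_cball by blast
  define V where "V = poly R ` ball z r"
  have "\<not> poly R constant_on ball z r"
  proof
    assume "poly R constant_on ball z r"
    then obtain y where y: "\<forall>x\<in>ball z r. poly (R - [:y:]) x = 0"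
      by (auto simp: constant_on_def)
    have "infinite (ball z r)"
      by (metis r(1) centre_in_ball empty_iff finite_imp_not_open open_ball)
    then have "infinite {x. poly (R - [:y:]) x = 0}"
      using y finite_subset[of "ball z r" "{x. poly (R - [:y:]) x = 0}"] by blast
    then have "R - [:y:] = 0" using poly_roots_finite by blast
    then have "R = [:y:]" by simp
    with assms(1) show False by simp
  qed
  then have "open V"
    unfolding V_def using r(1)
    by (intro open_mapping_thm[where S = "ball z r"])
       (auto intro: holomorphic_intros)
  moreover have "connected V"
    unfolding V_def by (intro connected_continuous_image continuous_intros) auto
  moreover have "poly R z \<in> V" unfolding V_def using r(1) by auto
  moreover have "normal_family_on (range (\<lambda>n. poly R ^^ n)) V"
    unfolding normal_family_on_def
  proof (intro allI impI)
    fix f :: "nat \<Rightarrow> complex \<Rightarrow> complex"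
    assume f: "range f \<subseteq> range (\<lambda>n. poly R ^^ n)"
    have "\<exists>m. f n = poly R ^^ m" for n using f by blast
    then obtain m where m: "\<And>n. f n = poly R ^^ m n" by metis
    define h where "h n = f n \<circ> poly R" for n
    have "h n = poly R ^^ Suc (m n)" for n
      by (simp add: h_def m funpow_Suc_right del: funpow.simps)
    then have "range h \<subseteq> range (\<lambda>n. poly R ^^ n)" by blast
    with nf obtain s where s: "strict_mono s" and
      alt: "(\<exists>g. \<forall>K. compact K \<and> K \<subseteq> U \<longrightarrow> uniform_limit K (\<lambda>n. h (s n)) g sequentially) \<or>
        (\<forall>K. compact K \<and> K \<subseteq> U \<longrightarrow> (\<forall>B. \<forall>\<^sub>F n in sequentially. \<forall>z\<in>K. B \<le> norm (h (s n) z)))"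
      unfolding normal_family_on_def by blast
    have V: "\<exists>w\<in>cball z r. y = poly R w" if "y \<in> V" for y
      using that unfolding V_def by auto
    show "\<exists>r. strict_mono r \<and>
           ((\<exists>g. \<forall>K. compact K \<and> K \<subseteq> V \<longrightarrow> uniform_limit K (\<lambda>n. f (r n)) g sequentially) \<or>
            (\<forall>K. compact K \<and> K \<subseteq> V \<longrightarrow> (\<forall>B. \<forall>\<^sub>F n in sequentially. \<forall>z\<in>K. B \<le> norm (f (r n) z))))"
    proof (intro exI conjI)
      show "strict_mono s" by fact
      show "(\<exists>g. \<forall>K. compact K \<and> K \<subseteq> V \<longrightarrow> uniform_limit K (\<lambda>n. f (s n)) g sequentially) \<or>
        (\<forall>K. compact K \<and> K \<subseteq> V \<longrightarrow> (\<forall>B. \<forall>\<^sub>F n in sequentially. \<forall>z\<in>K. B \<le> norm (f (s n) z)))"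
        using alt
      proof (elim disjE exE)
        fix g assume "\<forall>K. compact K \<and> K \<subseteq> U \<longrightarrow> uniform_limit K (\<lambda>n. h (s n)) g sequentially"
        then have lim: "uniform_limit (cball z r) (\<lambda>n. h (s n)) g sequentially"
          using r(2) by simp
        \<comment> \<open>A choice of preimages in the closed disc. It transports the limit
          \<open>g\<close> of the pulled-back sequence to the limit \<open>g \<circ> p\<close> of
          the original one on all of \<open>V\<close>.\<close>
        define p where "p y = (SOME w. w \<in> cball z r \<and> y = poly R w)" for y
        have p: "p y \<in> cball z r \<and> y = poly R (p y)" if "y \<in> V" for y
          unfolding p_def by (rule someI_ex) (use V[OF that] in blast)
        have "uniform_limit V (\<lambda>n. f (s n)) (g \<circ> p) sequentially"
        proof (rule uniform_limitI)
          fix e :: real assume "e > 0"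
          with lim have "\<forall>\<^sub>F n in sequentially. \<forall>x\<in>cball z r. dist (h (s n) x) (g x) < e"
            by (rule uniform_limitD)
          then show "\<forall>\<^sub>F n in sequentially. \<forall>x\<in>V. dist (f (s n) x) ((g \<circ> p) x) < e"
          proof eventually_elim
            case (elim n)
            show ?case
            proof
              fix y assume "y \<in> V"
              then have "p y \<in> cball z r" "poly R (p y) = y" using p by auto
              then show "dist (f (s n) y) ((g \<circ> p) y) < e" using elim by (force simp: h_def)
            qed
          qed
        qed
        then show ?thesis by (meson uniform_limit_on_subset)
      next
        assume "\<forall>K. compact K \<and> K \<subseteq> U \<longrightarrow> (\<forall>B. \<forall>\<^sub>F n in sequentially. \<forall>z\<in>K. B \<le> norm (h (s n) z))"
        then have *: "\<forall>\<^sub>F n in sequentially. \<forall>z\<in>cball z r. B \<le> norm (h (s n) z)" for B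
          using r(2) by simp
        have "\<forall>\<^sub>F n in sequentially. \<forall>y\<in>V. B \<le> norm (f (s n) y)" for B
          using *[of B]
        proof eventually_elim
          case (elim n)
          then show ?case using V by (force simp: h_def)
        qed
        then have "\<forall>K. compact K \<and> K \<subseteq> V \<longrightarrow> (\<forall>B. \<forall>\<^sub>F n in sequentially. \<forall>z\<in>K. B \<le> norm (f (s n) z))"
          by (smt (verit) eventually_mono subsetD)
        then show ?thesis by blast
      qed
    qed
  qed
  ultimately show ?thesis unfolding fatou_set_def by blast
qed

text \<open>Outside a large disc \<open>R\<close> at least doubles the modulus, so all orbits there
  tend to infinity at a uniform rate. This is the alternative in normality that allows the limit
  infinity.\<close>

lemma escaping_subset_fatou_set:
  assumes "degree R \<ge> 2"
  obtains \<rho> where "{z. norm z > \<rho>} \<subseteq> fatou_set R"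
proof -
  obtain a b Q where R: "R = pCons a (pCons b Q)" by (metis pCons_cases)
  with assms have "Q \<noteq> 0" by (auto split: if_splits)
  \<comment> \<open>The summand \<open>norm a\<close> pays for the constant coefficient and leaves
    the growth factor 2.\<close>
  then obtain r where r: "\<forall>z. r \<le> norm z \<longrightarrow> 2 + norm a \<le> norm (poly (pCons b Q) z)"
    using poly_infinity by blast
  define \<rho> where "\<rho> = max r 1"
  have grow: "2 * norm z \<le> norm (poly R z)" if "norm z \<ge> \<rho>" for z
  proof -
    have z: "norm z \<ge> 1" "norm z \<ge> r" using that by (auto simp: \<rho>_def)
    have "(2 + norm a) * norm z \<le> norm (poly (pCons b Q) z) * norm z"
      using r z(2) by (intro mult_right_mono) auto
    moreover have "norm (z * poly (pCons b Q) z) - norm a \<le> norm (poly R z)"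
      unfolding R by (metis add.commute norm_diff_ineq poly_pCons)
    moreover have "norm a \<le> norm a * norm z" using z(1) by (simp add: mult_left_le_imp_le mult_le_cancel_left1)
    ultimately show ?thesis by (simp add: norm_mult algebra_simps del: poly_pCons)
  qed
  have iter: "2 ^ n * norm z \<le> norm ((poly R ^^ n) z)" if "norm z \<ge> \<rho>" for z n
  proof (induction n)
    case (Suc n)
    have "norm z \<le> 2 ^ n * norm z" by (simp add: mult_le_cancel_right1)
    with Suc that have "\<rho> \<le> norm ((poly R ^^ n) z)" by linarith
    from grow[OF this] Suc show ?case by simp
  qed simp
  have "z \<in> fatou_set R" if z: "norm z > \<rho>" for z
  proof -
    define U where "U = ball z (norm z - \<rho>)"
    have U: "norm w \<ge> \<rho>" if "w \<in> U" for w
      using that norm_triangle_ineq2[of z w] by (auto simp: U_def dist_norm)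
    have "normal_family_on (range (\<lambda>n. poly R ^^ n)) U"
      unfolding normal_family_on_def
    proof (intro allI impI)
      fix f :: "nat \<Rightarrow> complex \<Rightarrow> complex"
      assume f: "range f \<subseteq> range (\<lambda>n. poly R ^^ n)"
      have "\<exists>m. f n = poly R ^^ m" for n using f by blast
      then obtain m where m: "\<And>n. f n = poly R ^^ m n" by metis
      show "\<exists>r. strict_mono r \<and>
           ((\<exists>g. \<forall>K. compact K \<and> K \<subseteq> U \<longrightarrow> uniform_limit K (\<lambda>n. f (r n)) g sequentially) \<or>
            (\<forall>K. compact K \<and> K \<subseteq> U \<longrightarrow> (\<forall>B. \<forall>\<^sub>F n in sequentially. \<forall>z\<in>K. B \<le> norm (f (r n) z))))"
      \<comment> \<open>A sequence of iterates either repeats one exponent infinitely often, which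
        gives a constant subsequence, or its exponents tend to infinity.\<close>
      proof (cases "\<exists>j. infinite {n. m n = j}")
        case True
        then obtain j where j: "infinite {n. m n = j}" by blast
        have "f (enumerate {n. m n = j} n) = poly R ^^ j" for n
          using enumerate_in_set[OF j, of n] by (simp add: m)
        then have "uniform_limit K (\<lambda>n. f (enumerate {n. m n = j} n)) (poly R ^^ j) sequentially" for K
          by (simp add: uniform_limit_const)
        then show ?thesis using strict_mono_enumerate[OF j] by blast
      next
        case False
        have top: "filterlim m at_top sequentially"
          unfolding filterlim_at_top eventually_sequentially
        proof
          fix Z
          have "finite (\<Union>j<Z. {n. m n = j})" using False by auto
          also have "(\<Union>j<Z. {n. m n = j}) = {n. m n < Z}" by auto
          finally obtain M where "\<forall>n\<in>{n. m n < Z}. n \<le> M" by (meson finite_nat_set_iff_bounded_le)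
          then show "\<exists>M. \<forall>n\<ge>M. Z \<le> m n" by (metis linorder_not_le mem_Collect_eq not_less_eq_eq)
        qed
        have "\<forall>\<^sub>F n in sequentially. \<forall>w\<in>U. B \<le> norm (f n w)" for B
        proof -
          obtain k where k: "B < 2 ^ k" using real_arch_pow[of 2 B] by auto
          have "\<forall>\<^sub>F n in sequentially. k \<le> m n" using top by (auto simp: filterlim_at_top)
          then show ?thesis
          proof eventually_elim
            case (elim n)
            show ?case
            proof
              fix w assume w: "w \<in> U"
              have "norm w \<ge> 1" using U[OF w] by (auto simp: \<rho>_def)
              then have "(2::real) ^ m n * 1 \<le> 2 ^ m n * norm w" by (intro mult_left_mono) auto
              moreover have "(2::real) ^ k \<le> 2 ^ m n" using elim by simp
              ultimately show "B \<le> norm (f n w)" using k iter[OF U[OF w], of "m n"] unfolding m[of n] by linarith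
            qed
          qed
        qed
        then have "\<forall>K. compact K \<and> K \<subseteq> U \<longrightarrow> (\<forall>B. \<forall>\<^sub>F n in sequentially. \<forall>z\<in>K. B \<le> norm (f (id n) z))"
          by (smt (verit) eventually_mono id_apply subsetD)
        then show ?thesis using strict_mono_id by blast
      qed
    qed
    moreover have "open U" "connected U" "z \<in> U" using z by (auto simp: U_def)
    ultimately show ?thesis unfolding fatou_set_def by blast
  qed
  then show ?thesis using that[of \<rho>] by blast
qed

text \<open>The derivatives of the iterates at \<open>a\<close> are the powers of a number of
  modulus greater than 1. A locally uniform limit would bound them through Cauchy's estimate, and
  divergence to infinity fails because \<open>a\<close> stays fixed.\<close>

lemma repelling_fixpoint_in_julia_set:
  assumes "poly R a = a" and "norm (poly (pderiv R) a) > 1"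
  shows "a \<in> julia_set R"
proof (rule ccontr)
  assume "a \<notin> julia_set R"
  then obtain U where U: "open U" "a \<in> U" and nf: "normal_family_on (range (\<lambda>n. poly R ^^ n)) U"
    unfolding julia_set_def fatou_set_def by blast
  obtain \<rho> where \<rho>: "\<rho> > 0" "cball a \<rho> \<subseteq> U" using U open_contains_cball by blast
  have fix_a: "(poly R ^^ n) a = a" for n by (induction n) (auto simp: assms(1))
  have der: "((poly R ^^ n) has_field_derivative poly (pderiv R) a ^ n) (at a)" for n
  proof (induction n)
    case (Suc n)
    from DERIV_chain[OF _ Suc, of "poly R" "poly (pderiv R) a"] show ?case
      by (simp add: fix_a poly_DERIV o_def)
  qed (auto simp: id_def)
  have hol: "(poly R ^^ n) holomorphic_on UNIV" for n
  proof (induction n)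
    case (Suc n)
    have "poly R holomorphic_on (poly R ^^ n) ` UNIV" by (intro holomorphic_intros)
    with Suc have "(poly R \<circ> (poly R ^^ n)) holomorphic_on UNIV" by (rule holomorphic_on_compose)
    then show ?case by (simp add: o_def)
  qed (simp add: id_def)
  obtain s where s: "strict_mono s" and
    alt: "(\<exists>g. \<forall>K. compact K \<and> K \<subseteq> U \<longrightarrow> uniform_limit K (\<lambda>n. poly R ^^ s n) g sequentially) \<or>
        (\<forall>K. compact K \<and> K \<subseteq> U \<longrightarrow> (\<forall>B. \<forall>\<^sub>F n in sequentially. \<forall>z\<in>K. B \<le> norm ((poly R ^^ s n) z)))"
    using nf[unfolded normal_family_on_def, rule_format, OF subset_refl] by (elim exE conjE)
  from alt show False
  proof (elim disjE exE)
    fix g assume "\<forall>K. compact K \<and> K \<subseteq> U \<longrightarrow> uniform_limit K (\<lambda>n. poly R ^^ s n) g sequentially"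
    then have lim: "uniform_limit (cball a \<rho>) (\<lambda>n. poly R ^^ s n) g sequentially"
      using \<rho>(2) by simp
    have "continuous_on (cball a \<rho>) g"
      by (rule uniform_limit_theorem[OF _ lim])
         (auto intro!: always_eventually holomorphic_on_imp_continuous_on holomorphic_on_subset[OF hol])
    then have "bounded (g ` cball a \<rho>)"
      by (intro compact_imp_bounded compact_continuous_image) auto
    then obtain B where B: "\<And>x. x \<in> cball a \<rho> \<Longrightarrow> norm (g x) \<le> B"
      unfolding bounded_iff by blast
    have "\<forall>\<^sub>F n in sequentially. \<forall>x\<in>cball a \<rho>. dist ((poly R ^^ s n) x) (g x) < 1"
      by (rule uniform_limitD[OF lim]) simp
    then have "\<forall>\<^sub>F n in sequentially. norm (poly (pderiv R) a) ^ s n \<le> (B + 1) / \<rho>"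
    proof eventually_elim
      case (elim n)
      have "norm ((deriv ^^ 1) (poly R ^^ s n) a) \<le> fact 1 * (B + 1) / \<rho> ^ 1"
      proof (rule Cauchy_inequality)
        fix x assume "norm (a - x) = \<rho>"
        then have x: "x \<in> cball a \<rho>" by (simp add: dist_norm)
        have "norm ((poly R ^^ s n) x) \<le> norm (g x) + dist ((poly R ^^ s n) x) (g x)"
          by (metis add.commute dist_norm norm_triangle_sub add.commute)
        with elim x B[OF x] show "norm ((poly R ^^ s n) x) \<le> B + 1" by fastforce
      qed (use \<rho>(1) hol holomorphic_on_imp_continuous_on holomorphic_on_subset in \<open>blast+\<close>)
      moreover have "deriv (poly R ^^ s n) a = poly (pderiv R) a ^ s n"
        by (rule DERIV_imp_deriv[OF der])
      ultimately show ?case by (simp add: norm_power)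
    qed
    moreover obtain k where k: "(B + 1) / \<rho> < norm (poly (pderiv R) a) ^ k"
      using real_arch_pow[OF assms(2)] by blast
    have "\<forall>\<^sub>F n in sequentially. (B + 1) / \<rho> < norm (poly (pderiv R) a) ^ s n"
      using eventually_ge_at_top[of k]
    proof eventually_elim
      case (elim n)
      then have "k \<le> s n" using seq_suble[OF s, of n] by simp
      then have "norm (poly (pderiv R) a) ^ k \<le> norm (poly (pderiv R) a) ^ s n"
        using assms(2) by (intro power_increasing) auto
      with k show ?case by linarith
    qed
    ultimately have "\<forall>\<^sub>F n::nat in sequentially. False" by eventually_elim simp
    then show False by simp
  next
    assume *: "\<forall>K. compact K \<and> K \<subseteq> U \<longrightarrow> (\<forall>B. \<forall>\<^sub>F n in sequentially. \<forall>z\<in>K. B \<le> norm ((poly R ^^ s n) z))"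
    have "\<forall>\<^sub>F n in sequentially. \<forall>z\<in>{a}. norm a + 1 \<le> norm ((poly R ^^ s n) z)"
      using U(2) by (intro *[rule_format]) simp
    then show False by (simp add: fix_a)
  qed
qed

lemma julia_set_backward:
  assumes "degree R > 0" and "poly R z \<in> julia_set R"
  shows "z \<in> julia_set R"
  using poly_image_fatou_set[OF assms(1), of z] assms(2) by (auto simp: julia_set_def)

text \<open>The real Julia set is compact, so its supremum \<open>b\<close> is attained. That
  \<open>b\<close> is itself a Julia point matters later: backward invariance then locates the roots
  of \<open>R - b\<close>.\<close>

lemma julia_hull_eq:
  assumes "degree R \<ge> 2" and "0 \<in> julia_set R" and "julia_set R \<subseteq> complex_of_real ` {0..}"
  obtains b where "julia_hull R = {0..b}" "b \<ge> 0" "of_real b \<in> julia_set R"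
    "julia_set R \<subseteq> complex_of_real ` {0..b}"
proof -
  define X where "X = complex_of_real -` julia_set R"
  have X0: "0 \<in> X" using assms(2) by (simp add: X_def)
  have X_nonneg: "x \<ge> 0" if "x \<in> X" for x using that assms(3) by (auto simp: X_def)
  have "closed X"
    unfolding X_def julia_set_def using open_fatou_set
    by (intro closed_vimage continuous_intros) auto
  moreover obtain \<rho> where \<rho>: "{z. norm z > \<rho>} \<subseteq> fatou_set R"
    using escaping_subset_fatou_set[OF assms(1)] by blast
  have bound: "norm x \<le> \<rho>" if "x \<in> X" for x
  proof (rule ccontr)
    assume "\<not> ?thesis"
    then have "complex_of_real x \<in> fatou_set R" using \<rho> by auto
    then show False using that by (simp add: X_def julia_set_def)
  qed
  then have "bounded X" by (auto simp: bounded_iff)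
  ultimately have "compact X" by (simp add: compact_eq_bounded_closed)
  then obtain b where b: "b \<in> X" "\<And>x. x \<in> X \<Longrightarrow> x \<le> b"
    using compact_attains_sup[of X] X0 by blast
  have "convex hull X = {0..b}"
  proof
    show "convex hull X \<subseteq> {0..b}"
      using b X_nonneg by (intro hull_minimal) auto
    have "{0..b} = closed_segment 0 b" using X_nonneg[OF b(1)] by (simp add: closed_segment_eq_real_ivl)
    also have "\<dots> \<subseteq> convex hull X"
      using X0 b(1) by (intro closed_segment_subset_convex_hull hull_inc)
    finally show "{0..b} \<subseteq> convex hull X" .
  qed
  then show ?thesis
    using that[of b] b X_nonneg assms(3) by (force simp: julia_hull_def X_def)
qed

section \<open>Real-rooted polynomials\<close>

text \<open>Here \<open>a\<close> is the leading coefficient. Keeping the roots in a multiset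
  permits induction over the linear factors.\<close>

definition poly_of_roots :: "'a::field_char_0 \<Rightarrow> 'a multiset \<Rightarrow> 'a poly" where
  "poly_of_roots a A = smult a (\<Prod>r\<in>#A. [:-r, 1:])"

lemma poly_of_roots_add_mset: "poly_of_roots a (add_mset r A) = [:-r, 1:] * poly_of_roots a A"
  by (simp add: poly_of_roots_def)

lemma poly_of_roots_empty [simp]: "poly_of_roots a {#} = [:a:]"
  by (simp add: poly_of_roots_def)

lemma poly_poly_of_roots_eq_0_iff: "a \<noteq> 0 \<Longrightarrow> poly (poly_of_roots a A) x = 0 \<longleftrightarrow> x \<in># A"
  by (induction A) (auto simp: poly_of_roots_add_mset)

lemma degree_poly_of_roots: "a \<noteq> 0 \<Longrightarrow> degree (poly_of_roots a A) = size A"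
proof (induction A)
  case (add r A)
  then have "poly_of_roots a A \<noteq> 0" by (auto simp: poly_of_roots_def)
  with add show ?case by (simp add: poly_of_roots_add_mset degree_mult_eq del: mult_pCons_left)
qed simp

lemma pderiv_poly_of_roots_add_mset:
  "poly (pderiv (poly_of_roots a (add_mset r A))) x =
    poly (poly_of_roots a A) x + (x - r) * poly (pderiv (poly_of_roots a A)) x"
  unfolding poly_of_roots_add_mset pderiv_mult by (simp add: pderiv_pCons algebra_simps)

lemma pderiv2_poly_of_roots_add_mset:
  "poly (pderiv (pderiv (poly_of_roots a (add_mset r A)))) x =
    2 * poly (pderiv (poly_of_roots a A)) x + (x - r) * poly (pderiv (pderiv (poly_of_roots a A))) x"
  unfolding poly_of_roots_add_mset pderiv_mult pderiv_add by (simp add: pderiv_pCons algebra_simps)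

text \<open>How the defect \<open>f'^2 - f'' f\<close> changes under a further linear factor: it is
  multiplied by a square and gains a square, so nonnegativity is inherited.\<close>

lemma laguerre_defect:
  fixes a x :: "'a::field_char_0" and A r
  defines "q \<equiv> poly_of_roots a A" and "p \<equiv> poly_of_roots a (add_mset r A)"
  shows "(poly (pderiv p) x)\<^sup>2 - poly (pderiv (pderiv p)) x * poly p x =
    (x - r)\<^sup>2 * ((poly (pderiv q) x)\<^sup>2 - poly (pderiv (pderiv q)) x * poly q x) + (poly q x)\<^sup>2"
proof -
  have p: "poly p x = (x - r) * poly q x"
    by (simp add: p_def q_def poly_of_roots_add_mset algebra_simps)
  define y where "y = x - r"
  show ?thesis
    unfolding p unfolding p_def pderiv_poly_of_roots_add_mset pderiv2_poly_of_roots_add_mset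
    unfolding q_def[symmetric] y_def[symmetric]
    by (simp add: algebra_simps power2_eq_square)
qed

lemma laguerre_inequality_weak:
  fixes a x :: real
  shows "poly (pderiv (pderiv (poly_of_roots a A))) x * poly (poly_of_roots a A) x
    \<le> (poly (pderiv (poly_of_roots a A)) x)\<^sup>2"
proof (induction A)
  case (add r A)
  have "0 \<le> (x - r)\<^sup>2 * ((poly (pderiv (poly_of_roots a A)) x)\<^sup>2
    - poly (pderiv (pderiv (poly_of_roots a A))) x * poly (poly_of_roots a A) x)"
    using add by (intro mult_nonneg_nonneg) auto
  moreover have "0 \<le> (poly (poly_of_roots a A) x)\<^sup>2" by (rule zero_le_power2)
  ultimately show ?case using laguerre_defect[of a r A x] by linarith
qed (simp add: pderiv_pCons)

text \<open>Splitting off one root leaves the square of the remaining factor, which is positive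
  because the whole product does not vanish.\<close>

lemma laguerre_inequality:
  fixes a x :: real
  assumes "A \<noteq> {#}" and "poly (poly_of_roots a A) x \<noteq> 0"
  shows "poly (pderiv (pderiv (poly_of_roots a A))) x * poly (poly_of_roots a A) x
    < (poly (pderiv (poly_of_roots a A)) x)\<^sup>2"
proof -
  obtain r B where A: "A = add_mset r B" using assms(1) by (meson multiset_cases)
  have "0 \<le> (x - r)\<^sup>2 * ((poly (pderiv (poly_of_roots a B)) x)\<^sup>2
    - poly (pderiv (pderiv (poly_of_roots a B))) x * poly (poly_of_roots a B) x)"
    using laguerre_inequality_weak[of a B x] by (intro mult_nonneg_nonneg) auto
  moreover have "0 < (poly (poly_of_roots a B) x)\<^sup>2"
    using assms(2) by (simp add: A poly_of_roots_add_mset)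
  ultimately show ?thesis using laguerre_defect[of a r B x] unfolding A by linarith
qed

text \<open>The partial fraction expansion of the logarithmic derivative. The signs of its summands
  drive the next three results about zeros of the derivative.\<close>

lemma pderiv_poly_of_roots_log_deriv:
  fixes a x :: "'a::field_char_0"
  assumes "x \<notin># A"
  shows "poly (pderiv (poly_of_roots a A)) x = poly (poly_of_roots a A) x * (\<Sum>r\<in>#A. 1 / (x - r))"
  using assms
proof (induction A)
  case (add r A)
  then have "x - r \<noteq> 0" by auto
  with add show ?case
    unfolding pderiv_poly_of_roots_add_mset by (simp add: poly_of_roots_add_mset field_simps)
qed (simp add: pderiv_pCons)

lemma sum_mset_pos:
  fixes f :: "'a \<Rightarrow> real"
  assumes "A \<noteq> {#}" and "\<And>x. x \<in># A \<Longrightarrow> f x > 0"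
  shows "(\<Sum>x\<in>#A. f x) > 0"
  using assms
proof (induction A)
  case (add x A)
  then show ?case by (cases "A = {#}") (auto intro: add_pos_pos)
qed simp

text \<open>To the right of all roots every summand \<open>1 / (x - r)\<close> is positive; to the
  left, in the next lemma, every one is negative.\<close>

lemma pderiv_poly_of_roots_pos:
  fixes a x :: real
  assumes "A \<noteq> {#}" and "a \<noteq> 0" and "\<And>r. r \<in># A \<Longrightarrow> r < x"
  shows "poly (pderiv (poly_of_roots a A)) x * poly (poly_of_roots a A) x > 0"
proof -
  have x: "x \<notin># A" using assms(3) by blast
  have "(\<Sum>r\<in>#A. 1 / (x - r)) > 0" using assms by (intro sum_mset_pos) auto
  moreover have "poly (poly_of_roots a A) x \<noteq> 0" using x assms(2) by (simp add: poly_poly_of_roots_eq_0_iff)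
  ultimately have "(poly (poly_of_roots a A) x)\<^sup>2 * (\<Sum>r\<in>#A. 1 / (x - r)) > 0"
    by (simp add: zero_less_mult_iff)
  then show ?thesis by (simp add: pderiv_poly_of_roots_log_deriv[OF x] power2_eq_square ac_simps)
qed

lemma pderiv_poly_of_roots_neg:
  fixes a x :: real
  assumes "A \<noteq> {#}" and "a \<noteq> 0" and "\<And>r. r \<in># A \<Longrightarrow> x < r"
  shows "poly (pderiv (poly_of_roots a A)) x * poly (poly_of_roots a A) x < 0"
proof -
  have x: "x \<notin># A" using assms(3) by blast
  have "(\<Sum>r\<in>#A. 1 / (r - x)) > 0" using assms by (intro sum_mset_pos) auto
  also have "(\<Sum>r\<in>#A. 1 / (r - x)) = (\<Sum>r\<in>#A. - (1 / (x - r)))"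
    by (intro arg_cong[where f = sum_mset] image_mset_cong) (simp add: minus_divide_right)
  also have "\<dots> = - (\<Sum>r\<in>#A. 1 / (x - r))"
    by (induction A) auto
  finally have "(\<Sum>r\<in>#A. 1 / (x - r)) < 0" by simp
  moreover have "poly (poly_of_roots a A) x \<noteq> 0" using x assms(2) by (simp add: poly_poly_of_roots_eq_0_iff)
  ultimately have "(poly (poly_of_roots a A) x)\<^sup>2 * (\<Sum>r\<in>#A. 1 / (x - r)) < 0"
    by (simp add: mult_less_0_iff)
  then show ?thesis by (simp add: pderiv_poly_of_roots_log_deriv[OF x] power2_eq_square ac_simps)
qed

text \<open>The Gauss-Lucas argument: for real \<open>r\<close> the imaginary part of
  \<open>1 / (z - r)\<close> has the sign opposite to that of \<open>Im z\<close>, so the summands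
  cannot cancel.\<close>

lemma pderiv_poly_of_roots_nonreal:
  fixes a z :: complex
  assumes "A \<noteq> {#}" and "a \<noteq> 0" and "\<And>r. r \<in># A \<Longrightarrow> r \<in> \<real>" and "z \<notin> \<real>"
  shows "poly (pderiv (poly_of_roots a A)) z \<noteq> 0"
proof -
  have z: "z \<notin># A" "Im z \<noteq> 0" using assms(3,4) by (auto simp: complex_is_Real_iff)
  have sign: "- Im z * Im (1 / (z - r)) > 0" if "r \<in># A" for r
  proof -
    have "z \<noteq> r" using that z(1) by auto
    then have "0 < (Re z - Re r)\<^sup>2 + (Im z)\<^sup>2" using z(2) by (simp add: add_nonneg_pos)
    moreover have "Im r = 0" using assms(3)[OF that] by (simp add: complex_is_Real_iff)
    ultimately show ?thesis using z(2) by (simp add: Im_divide power2_eq_square zero_less_mult_iff not_less_iff_gr_or_eq zero_less_divide_iff) auto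
  qed
  have "- Im z * Im (\<Sum>r\<in>#A. 1 / (z - r)) = (\<Sum>r\<in>#A. - Im z * Im (1 / (z - r)))"
    by (induction A) (auto simp: algebra_simps)
  also have "\<dots> > 0" using assms(1) sign by (rule sum_mset_pos)
  finally have "(\<Sum>r\<in>#A. 1 / (z - r)) \<noteq> 0" by auto
  moreover have "poly (poly_of_roots a A) z \<noteq> 0" using z assms(2) by (simp add: poly_poly_of_roots_eq_0_iff)
  ultimately show ?thesis by (simp add: pderiv_poly_of_roots_log_deriv[OF z(1)])
qed

section \<open>Real polynomials over the complex numbers, and signs at interval ends\<close>

abbreviation cpoly :: "real poly \<Rightarrow> complex poly" where
  "cpoly \<equiv> map_poly complex_of_real"

lemma poly_cpoly [simp]: "poly (cpoly p) (complex_of_real x) = complex_of_real (poly p x)"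
  by (induction p) (auto simp: map_poly_pCons)

lemma pderiv_cpoly: "pderiv (cpoly p) = cpoly (pderiv p)"
  by (intro poly_eqI) (simp add: coeff_pderiv coeff_map_poly)

lemma cpoly_mult: "cpoly (p * q) = cpoly p * cpoly q"
  by (intro poly_eqI) (simp add: coeff_mult coeff_map_poly)

lemma cpoly_diff: "cpoly (p - q) = cpoly p - cpoly q"
  by (intro poly_eqI) (simp add: coeff_map_poly)

lemma degree_cpoly [simp]: "degree (cpoly p) = degree p"
  by (cases "p = 0") (auto intro: map_poly_degree_eq)

lemma cpoly_const: "cpoly [:a:] = [:of_real a:]"
  by (simp add: map_poly_pCons)

lemma cpoly_eq_iff: "cpoly p = cpoly q \<longleftrightarrow> p = q"
  by (auto simp: poly_eq_iff coeff_map_poly)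

lemma cpoly_poly_of_roots:
  "cpoly (poly_of_roots a A) = poly_of_roots (of_real a) (image_mset of_real A)"
  by (induction A) (auto simp: poly_of_roots_add_mset cpoly_mult cpoly_const map_poly_pCons simp del: mult_pCons_left)

text \<open>Applied with \<open>q\<close> equal to the derivative of \<open>p\<close> or its
  negative on a lap, this gives the sign of the second derivative at a critical end point.\<close>

lemma poly_deriv_nonneg_at_left_end:
  fixes q :: "real poly"
  assumes "x < y" and "poly q x = 0" and "\<And>t. x < t \<Longrightarrow> t < y \<Longrightarrow> poly q t > 0"
  shows "poly (pderiv q) x \<ge> 0"
proof (rule ccontr)
  assume "\<not> ?thesis"
  then obtain d where d: "d > 0" "\<And>h. h > 0 \<Longrightarrow> h < d \<Longrightarrow> poly q (x + h) < poly q x"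
    using DERIV_neg_dec_right[OF poly_DERIV[of q x]] by auto
  define h where "h = min d (y - x) / 2"
  have "h > 0" "h < d" "x + h < y" using d(1) assms(1) by (auto simp: h_def min_def field_simps)
  with d(2)[of h] assms(2) assms(3)[of "x + h"] show False by simp
qed

lemma poly_deriv_nonpos_at_right_end:
  fixes q :: "real poly"
  assumes "x < y" and "poly q y = 0" and "\<And>t. x < t \<Longrightarrow> t < y \<Longrightarrow> poly q t > 0"
  shows "poly (pderiv q) y \<le> 0"
proof (rule ccontr)
  assume "\<not> ?thesis"
  then obtain d where d: "d > 0" "\<And>h. h > 0 \<Longrightarrow> h < d \<Longrightarrow> poly q (y - h) < poly q y"
    using DERIV_pos_inc_left[OF poly_DERIV[of q y]] by auto
  define h where "h = min d (y - x) / 2"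
  have "h > 0" "h < d" "x < y - h" using d(1) assms(1) by (auto simp: h_def min_def field_simps)
  with d(2)[of h] assms(2) assms(3)[of "y - h"] show False by simp
qed

lemma poly_nonneg_at_ends:
  fixes q :: "real poly"
  assumes "x < y" and "\<And>t. x < t \<Longrightarrow> t < y \<Longrightarrow> poly q t > 0"
  shows "poly q x \<ge> 0" "poly q y \<ge> 0"
proof -
  have *: "0 \<le> poly q t" if "t \<in> closure {x<..<y}" for t
    by (rule continuous_ge_on_closure[OF _ that])
       (use assms in \<open>auto intro: continuous_intros less_imp_le\<close>)
  have "closure {x<..<y} = {x..y}" using assms(1) by simp
  then show "poly q x \<ge> 0" "poly q y \<ge> 0" using *[of x] *[of y] assms(1) by auto
qed

section \<open>Laps\<close>

text \<open>The real form of the situation: \<open>{0..b}\<close> is the hull of the Julia set, and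
  \<open>p\<close> as well as \<open>p - b\<close> has all its roots in it. The factorisations are
  parameters so that Laguerre's inequality applies to both polynomials.\<close>

locale full_lap_poly =
  fixes p :: "real poly" and N :: nat and b a a' :: real and A B :: "real multiset"
  assumes N: "N \<ge> 2" and b: "b > 0"
    and p_A: "p = poly_of_roots a A" "a \<noteq> 0" "size A = N" "set_mset A \<subseteq> {0..b}"
    and p_B: "p - [:b:] = poly_of_roots a' B" "a' \<noteq> 0" "set_mset B \<subseteq> {0..b}"
    and p_0: "poly p 0 = 0"
    and deriv_0: "poly (pderiv p) 0 > 1"
begin

section \<open>Critical points\<close>

definition crit :: "real set" where "crit = {x. poly (pderiv p) x = 0}"

lemma degree_p: "degree p = N"
  using degree_poly_of_roots[of a A] p_A by simp

lemma nonempty: "A \<noteq> {#}" "B \<noteq> {#}"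
proof -
  show "A \<noteq> {#}" using N p_A(3) by auto
  have "degree (p + - [:b:]) = degree p"
    using degree_p N by (intro degree_add_eq_left) simp
  then have "degree (p - [:b:]) = N" by (simp only: degree_p diff_conv_add_uminus)
  then show "B \<noteq> {#}" using degree_poly_of_roots[of a' B] p_B(1,2) N by auto
qed

lemma pderiv_B: "pderiv p = pderiv (poly_of_roots a' B)" "poly (poly_of_roots a' B) x = poly p x - b"
  unfolding p_B(1)[symmetric] by (simp_all add: pderiv_diff pderiv_pCons)

text \<open>At a critical point Laguerre's inequality for \<open>p\<close> reduces to
  \<open>p'' p < 0\<close>.\<close>

lemma crit_above: "poly (pderiv p) x = 0 \<Longrightarrow> poly p x > 0 \<Longrightarrow> poly (pderiv (pderiv p)) x < 0"
  using laguerre_inequality[OF nonempty(1), of a x] unfolding p_A(1)[symmetric]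
  by (auto simp: mult_less_0_iff)

text \<open>The same inequality for \<open>p - b\<close>, which has the same derivatives as
  \<open>p\<close>.\<close>

lemma crit_below: "poly (pderiv p) x = 0 \<Longrightarrow> poly p x < b \<Longrightarrow> poly (pderiv (pderiv p)) x > 0"
  using laguerre_inequality[OF nonempty(2), of a' x] unfolding pderiv_B(1)[symmetric] pderiv_B(2)
  by (auto simp: mult_less_0_iff)

text \<open>Since \<open>b > 0\<close>, every value of \<open>p\<close> is positive or below
  \<open>b\<close>, so one of the two preceding cases applies.\<close>

lemma crit_simple: "poly (pderiv p) x = 0 \<Longrightarrow> poly (pderiv (pderiv p)) x \<noteq> 0"
  using crit_above[of x] crit_below[of x] b by fastforce

text \<open>All roots of \<open>p\<close> are at most \<open>b\<close>, and \<open>x\<close> is no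
  root, so \<open>x\<close> lies strictly to the right of every root.\<close>

lemma right_pos: "x \<ge> b \<Longrightarrow> poly p x > 0 \<Longrightarrow> poly (pderiv p) x > 0"
proof -
  assume x: "x \<ge> b" "poly p x > 0"
  have "x \<notin># A" using x poly_poly_of_roots_eq_0_iff[OF p_A(2), of A x] p_A(1) by auto
  have "r < x" if "r \<in># A" for r
  proof -
    have "r \<le> b" using that p_A(4) by auto
    moreover have "r \<noteq> x" using that \<open>x \<notin># A\<close> by blast
    ultimately show ?thesis using x by linarith
  qed
  from pderiv_poly_of_roots_pos[OF nonempty(1) p_A(2) this] x show ?thesis
    unfolding p_A(1)[symmetric] by (simp add: zero_less_mult_iff)
qed

lemma right_neg: "x \<ge> b \<Longrightarrow> poly p x < b \<Longrightarrow> poly (pderiv p) x < 0"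
proof -
  assume x: "x \<ge> b" "poly p x < b"
  have "x \<notin># B" using x poly_poly_of_roots_eq_0_iff[OF p_B(2), of B x] pderiv_B(2)[of x] by auto
  have "r < x" if "r \<in># B" for r
  proof -
    have "r \<le> b" using that p_B(3) by auto
    moreover have "r \<noteq> x" using that \<open>x \<notin># B\<close> by blast
    ultimately show ?thesis using x by linarith
  qed
  from pderiv_poly_of_roots_pos[OF nonempty(2) p_B(2) this] x show ?thesis
    unfolding pderiv_B(1)[symmetric] pderiv_B(2) by (simp add: zero_less_mult_iff)
qed

lemma left_nonzero: "x < 0 \<Longrightarrow> poly (pderiv p) x \<noteq> 0"
proof -
  assume x: "x < 0"
  then have "x < r" if "r \<in># A" for r using that p_A(4) by force
  from pderiv_poly_of_roots_neg[OF nonempty(1) p_A(2) this] x show ?thesis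
    unfolding p_A(1)[symmetric] by auto
qed

lemma crit_subset: "crit \<subseteq> {0<..<b}"
proof
  fix x assume "x \<in> crit"
  then have x: "poly (pderiv p) x = 0" by (simp add: crit_def)
  have "x \<noteq> 0" using x deriv_0 by auto
  moreover have "\<not> x < 0" using x left_nonzero by auto
  moreover have "\<not> x \<ge> b" using x right_pos[of x] right_neg[of x] b by linarith
  ultimately show "x \<in> {0<..<b}" by simp
qed

lemma finite_crit: "finite crit"
proof -
  have "pderiv p \<noteq> 0" using deriv_0 by auto
  then show ?thesis unfolding crit_def by (rule poly_roots_finite)
qed

text \<open>All complex roots of the derivative are real by the Gauss-Lucas argument and simple by
  Laguerre's inequality, so their number is its degree.\<close>

lemma card_crit: "card crit = N - 1"
proof -
  define Q where "Q = cpoly (pderiv p)"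
  have "pderiv p \<noteq> 0" using deriv_0 by auto
  then have Q0: "Q \<noteq> 0" using cpoly_eq_iff[of "pderiv p" 0] by (simp add: Q_def)
  have Q: "Q = pderiv (poly_of_roots (of_real a) (image_mset of_real A))"
    unfolding Q_def by (simp add: pderiv_cpoly[symmetric] cpoly_poly_of_roots[symmetric] p_A(1)[symmetric])
  have real_root: "z \<in> complex_of_real ` crit" if "poly Q z = 0" for z
  proof -
    have "z \<in> \<real>"
      using pderiv_poly_of_roots_nonreal[of "image_mset of_real A" "of_real a" z] nonempty(1) p_A(2) that
      unfolding Q by (metis (no_types, lifting) Reals_of_real image_iff image_mset_is_empty_iff of_real_eq_0_iff set_image_mset)
    then obtain x where "z = of_real x" by (auto elim: Reals_cases)
    with that show ?thesis by (auto simp: Q_def crit_def)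
  qed
  have roots: "set_mset (proots Q) = complex_of_real ` crit"
    using real_root Q0 by (auto simp: Q_def crit_def)
  have "proots Q = mset_set (complex_of_real ` crit)"
  proof (rule multiset_eqI)
    fix z
    show "count (proots Q) z = count (mset_set (complex_of_real ` crit)) z"
    proof (cases "z \<in> complex_of_real ` crit")
      case True
      then obtain x where x: "z = of_real x" "x \<in> crit" by blast
      then have "poly Q z = 0" by (simp add: Q_def crit_def)
      moreover have "poly (pderiv Q) z \<noteq> 0"
        using x crit_simple[of x] by (simp add: Q_def pderiv_cpoly crit_def)
      ultimately have "order z Q = 1"
        using order_pderiv[OF Q0, of z] order_0I[of "pderiv Q" z] by simp
      with True finite_crit show ?thesis using Q0 by simp
    next
      case False
      then have "z \<notin># proots Q" using roots by blast
      then show ?thesis using False by (simp add: not_in_iff)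
    qed
  qed
  then have "degree Q = card (complex_of_real ` crit)"
    using size_proots_complex[of Q] by simp
  also have "\<dots> = card crit" by (rule card_image) (simp add: inj_on_def)
  finally show ?thesis using degree_p by (simp add: Q_def degree_pderiv)
qed

section \<open>Nodes between the laps, and the values of the polynomial there\<close>

definition node :: "nat \<Rightarrow> real" where
  "node i = (0 # sorted_list_of_set crit @ [b]) ! i"

lemma length_crit: "length (sorted_list_of_set crit) = N - 1"
  by (simp add: card_crit finite_crit)

lemma node_0 [simp]: "node 0 = 0"
  by (simp add: node_def)

lemma node_N [simp]: "node N = b"
  using N by (cases N) (simp_all add: node_def nth_append length_crit del: length_sorted_list_of_set)

lemma node_less: "i < j \<Longrightarrow> j \<le> N \<Longrightarrow> node i < node j"
proof -
  assume ij: "i < j" "j \<le> N"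
  have "sorted_wrt (<) (0 # sorted_list_of_set crit @ [b])"
    using crit_subset finite_crit b by (auto simp: sorted_wrt_append)
  then show ?thesis unfolding node_def
    by (rule sorted_wrt_nth_less) (use ij N length_crit in auto)
qed

lemma node_le: "i \<le> j \<Longrightarrow> j \<le> N \<Longrightarrow> node i \<le> node j"
  using node_less[of i j] by (cases "i = j") auto

lemma crit_eq: "crit = node ` {1..<N}"
proof -
  have "crit = (!) (sorted_list_of_set crit) ` {..<N - 1}"
    using finite_crit by (metis length_crit set_sorted_list_of_set nth_image lessThan_atLeast0 order_refl take_all)
  also have "\<dots> = (\<lambda>i. node (Suc i)) ` {..<N - 1}"
    by (intro image_cong) (auto simp: node_def nth_append length_crit simp del: length_sorted_list_of_set)
  also have "\<dots> = node ` (Suc ` {..<N - 1})" by (simp add: image_image)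
  also have "Suc ` {..<N - 1} = {1..<N}"
    using N by (auto simp: image_iff Suc_le_eq gr0_conv_Suc)
  finally show ?thesis .
qed

lemma pderiv_sign_on_lap:
  assumes "i < N"
  shows "(\<forall>t. node i < t \<longrightarrow> t < node (Suc i) \<longrightarrow> poly (pderiv p) t > 0) \<or>
         (\<forall>t. node i < t \<longrightarrow> t < node (Suc i) \<longrightarrow> poly (pderiv p) t < 0)"
proof -
  have nz: "poly (pderiv p) t \<noteq> 0" if t: "node i < t" "t < node (Suc i)" for t
  proof
    assume "poly (pderiv p) t = 0"
    then have "t \<in> crit" by (simp add: crit_def)
    then obtain j where j: "j \<in> {1..<N}" "t = node j" unfolding crit_eq by blast
    have "j \<le> i \<or> Suc i \<le> j" by linarith
    then show False using t j node_le[of j i] node_le[of "Suc i" j] assms by auto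
  qed
  show ?thesis
  proof (rule ccontr)
    assume "\<not> ?thesis"
    then obtain s t where s: "node i < s" "s < node (Suc i)" "\<not> poly (pderiv p) s > 0"
      and t: "node i < t" "t < node (Suc i)" "\<not> poly (pderiv p) t < 0" by blast
    have signs: "poly (pderiv p) s < 0" "poly (pderiv p) t > 0"
      using nz[of s] nz[of t] s t by linarith+
    then have "s \<noteq> t" by auto
    then consider "s < t" | "t < s" by linarith
    then have "\<exists>u. node i < u \<and> u < node (Suc i) \<and> poly (pderiv p) u = 0"
    proof cases
      case 1
      then show ?thesis using poly_IVT_pos[OF 1 signs] s(1) t(2) by (meson order_less_trans)
    next
      case 2
      then show ?thesis using poly_IVT_neg[OF 2 signs(2,1)] s(2) t(1) by (meson order_less_trans)
    qed
    then show False using nz by blast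
  qed
qed

lemma node_cases: "i \<le> N \<Longrightarrow> i = 0 \<or> i = N \<or> poly (pderiv p) (node i) = 0"
  using crit_eq by (cases "i = 0 \<or> i = N") (auto simp: crit_def)

text \<open>At a critical left end the second derivative is nonnegative, which
  \<open>crit_above\<close> forbids for a positive value; at a critical right end it is nonpositive,
  which \<open>crit_below\<close> forbids for a value below \<open>b\<close>. Only the ends of the
  hull need separate arguments.\<close>

lemma increasing_lap:
  assumes i: "i < N" and pos: "\<And>t. node i < t \<Longrightarrow> t < node (Suc i) \<Longrightarrow> poly (pderiv p) t > 0"
  shows "poly p (node i) \<le> 0" "b \<le> poly p (node (Suc i))"
proof -
  have less: "node i < node (Suc i)" using i by (simp add: node_less)
  show "poly p (node i) \<le> 0"
  proof (rule ccontr)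
    assume *: "\<not> ?thesis"
    have "i \<noteq> 0" by (rule notI) (use * p_0 in simp)
    then have crit: "poly (pderiv p) (node i) = 0" using node_cases[of i] i by auto
    have "poly (pderiv (pderiv p)) (node i) \<ge> 0"
      using less crit pos by (rule poly_deriv_nonneg_at_left_end)
    with crit_above[OF crit] * show False by simp
  qed
  show "b \<le> poly p (node (Suc i))"
  proof (rule ccontr)
    assume *: "\<not> ?thesis"
    show False
    proof (cases "Suc i = N")
      \<comment> \<open>The node \<open>b\<close> is not critical; here the roots of
        \<open>p - b\<close> determine the sign of the derivative, against its nonnegativity by
        continuity.\<close>
      case True
      then have "poly (pderiv p) b < 0" using right_neg[of b] * by simp
      with poly_nonneg_at_ends(2)[OF less pos] True show False by simp
    next
      case False
      then have crit: "poly (pderiv p) (node (Suc i)) = 0" using node_cases[of "Suc i"] i by auto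
      have "poly (pderiv (pderiv p)) (node (Suc i)) \<le> 0"
        using less crit pos by (rule poly_deriv_nonpos_at_right_end)
      with crit_below[OF crit] * show False by simp
    qed
  qed
qed

text \<open>The mirror image of the increasing case, with the two critical-point criteria
  exchanged.\<close>

lemma decreasing_lap:
  assumes i: "i < N" and neg: "\<And>t. node i < t \<Longrightarrow> t < node (Suc i) \<Longrightarrow> poly (pderiv p) t < 0"
  shows "b \<le> poly p (node i)" "poly p (node (Suc i)) \<le> 0"
proof -
  have less: "node i < node (Suc i)" using i by (simp add: node_less)
  have pos: "poly (- pderiv p) t > 0" if "node i < t" "t < node (Suc i)" for t
    using neg[OF that] by simp
  show "b \<le> poly p (node i)"
  proof (rule ccontr)
    assume *: "\<not> ?thesis"
    \<comment> \<open>The first lap cannot decrease: continuity would give a nonpositive derivative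
      at 0.\<close>
    have "i \<noteq> 0" by (rule notI) (use poly_nonneg_at_ends(1)[OF less pos] deriv_0 in simp)
    then have crit: "poly (pderiv p) (node i) = 0" using node_cases[of i] i by auto
    have "poly (pderiv (- pderiv p)) (node i) \<ge> 0"
      using less _ pos by (rule poly_deriv_nonneg_at_left_end) (simp add: crit)
    with crit_below[OF crit] * show False by (simp add: pderiv_minus)
  qed
  show "poly p (node (Suc i)) \<le> 0"
  proof (rule ccontr)
    assume *: "\<not> ?thesis"
    show False
    proof (cases "Suc i = N")
      case True
      then have "poly (pderiv p) b > 0" using right_pos[of b] * by simp
      with poly_nonneg_at_ends(2)[OF less pos] True show False by simp
    next
      case False
      then have crit: "poly (pderiv p) (node (Suc i)) = 0" using node_cases[of "Suc i"] i by auto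
      have "poly (pderiv (- pderiv p)) (node (Suc i)) \<le> 0"
        using less _ pos by (rule poly_deriv_nonpos_at_right_end) (simp add: crit)
      with crit_above[OF crit] * show False by (simp add: pderiv_minus)
    qed
  qed
qed

section \<open>The laps and the uniqueness of the lap decomposition\<close>

definition lap :: "nat \<Rightarrow> real set" where "lap i = {node i..node (Suc i)}"

lemma lap_mono:
  assumes "i < N"
  shows "mono_on (lap i) (poly p) \<or> antimono_on (lap i) (poly p)"
  using pderiv_sign_on_lap[OF assms]
proof
  assume *: "\<forall>t. node i < t \<longrightarrow> t < node (Suc i) \<longrightarrow> poly (pderiv p) t > 0"
  have "poly p x \<le> poly p y" if "x \<in> lap i" "y \<in> lap i" "x \<le> y" for x y
    using that(3)
  proof (rule DERIV_nonneg_imp_increasing_open)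
    fix t assume "x < t" "t < y"
    with * that show "\<exists>y. (poly p has_real_derivative y) (at t) \<and> 0 \<le> y"
      by (intro exI[of _ "poly (pderiv p) t"]) (force simp: lap_def poly_DERIV intro: less_imp_le)
  qed (intro continuous_intros)
  then show ?thesis by (auto intro: mono_onI)
next
  assume *: "\<forall>t. node i < t \<longrightarrow> t < node (Suc i) \<longrightarrow> poly (pderiv p) t < 0"
  have "poly p y \<le> poly p x" if "x \<in> lap i" "y \<in> lap i" "x \<le> y" for x y
    using that(3)
  proof (rule DERIV_nonpos_imp_decreasing_open)
    fix t assume "x < t" "t < y"
    with * that show "\<exists>y. (poly p has_real_derivative y) (at t) \<and> y \<le> 0"
      by (intro exI[of _ "poly (pderiv p) t"]) (force simp: lap_def poly_DERIV intro: less_imp_le)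
  qed (intro continuous_intros)
  then show ?thesis by (auto intro!: monotone_onI)
qed

lemma lap_image:
  assumes "i < N"
  shows "{0..b} \<subseteq> poly p ` lap i"
proof
  fix w assume w: "w \<in> {0..b}"
  have less: "node i < node (Suc i)" using assms by (simp add: node_less)
  have "\<exists>x. node i \<le> x \<and> x \<le> node (Suc i) \<and> poly p x = w"
    using pderiv_sign_on_lap[OF assms]
  proof
    assume "\<forall>t. node i < t \<longrightarrow> t < node (Suc i) \<longrightarrow> poly (pderiv p) t > 0"
    then show ?thesis using increasing_lap[OF assms] w less
      by (intro IVT') (force intro!: continuous_intros)+
  next
    assume "\<forall>t. node i < t \<longrightarrow> t < node (Suc i) \<longrightarrow> poly (pderiv p) t < 0"
    then show ?thesis using decreasing_lap[OF assms] w less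
      by (intro IVT2') (force intro!: continuous_intros)+
  qed
  then show "w \<in> poly p ` lap i" by (auto simp: lap_def)
qed

lemma Union_lap: "(\<Union>i<N. lap i) = {0..b}"
proof (intro equalityI subsetI)
  fix x assume "x \<in> (\<Union>i<N. lap i)"
  then obtain i where i: "i < N" "x \<in> lap i" by blast
  then show "x \<in> {0..b}"
    using node_le[of 0 i] node_le[of "Suc i" N] by (auto simp: lap_def)
next
  fix x assume x: "x \<in> {0..b}"
  have "\<exists>i<n. x \<in> lap i" if "x \<le> node n" "0 < n" "n \<le> N" for n
    using that
  proof (induction n)
    case (Suc n)
    then show ?case
      using x by (cases "n = 0 \<or> node n < x") (auto simp: lap_def less_Suc_eq)
  qed simp
  from this[of N] x N show "x \<in> (\<Union>i<N. lap i)" by auto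
qed

text \<open>A piece on which \<open>p\<close> is monotone has no critical point in its interior,
  hence lies in one lap. There are as many pieces as laps and every lap must be covered, so each
  piece fills its lap. This makes the definite description of the decomposition meaningful.\<close>

lemma is_lap_image_iff:
  assumes "degree R = N" and "julia_hull R = {0..b}" and "real_map R = poly p"
  shows "is_lap_decomposition R D \<longleftrightarrow> D = lap ` {..<N}"
proof
  have inj: "inj_on lap {..<N}"
  proof (rule inj_onI)
    fix i j assume ij: "i \<in> {..<N}" "j \<in> {..<N}" "lap i = lap j"
    have "node i < node (Suc i)" "node j < node (Suc j)" using ij node_less by auto
    with ij(3) have "node i = node j" by (auto simp: lap_def)
    then show "i = j" using node_less[of i j] node_less[of j i] ij by (cases i j rule: linorder_cases) auto
  qed
  have disj: "interior (lap i) \<inter> lap j = {}" if "i < N" "j < N" "i \<noteq> j" for i j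
  proof (cases "i < j")
    case True
    then have "node (Suc i) \<le> node j" using that by (intro node_le) auto
    then show ?thesis by (auto simp: lap_def)
  next
    case False
    then have "node (Suc j) \<le> node i" using that by (intro node_le) auto
    then show ?thesis by (auto simp: lap_def)
  qed
  {
    assume D: "D = lap ` {..<N}"
    have "pairwise (\<lambda>J J'. interior J \<inter> interior J' = {}) D"
      using disj interior_subset unfolding D pairwise_def by fast
    moreover have "card D = N" using inj by (simp add: D card_image)
    moreover have "\<exists>a b. a < b \<and> lap i = {a..b}" if "i < N" for i
      using that node_less[of i "Suc i"] by (auto simp: lap_def)
    ultimately show "is_lap_decomposition R D"
      unfolding is_lap_decomposition_def assms using lap_mono Union_lap by (auto simp: D)
  }
  assume "is_lap_decomposition R D"
  then have D: "finite D" "card D = N" "\<Union>D = {0..b}" "\<And>J. J \<in> D \<Longrightarrow> \<exists>a b. a < b \<and> J = {a..b}"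
    "\<And>J. J \<in> D \<Longrightarrow> mono_on J (poly p) \<or> antimono_on J (poly p)"
    unfolding is_lap_decomposition_def assms by auto
  have in_lap: "\<exists>i<N. J \<subseteq> lap i" if J: "J \<in> D" for J
  proof -
    obtain u v where uv: "u < v" "J = {u..v}" using D(4)[OF J] by blast
    have "J \<subseteq> {0..b}" using D(3) J by blast
    then have uv': "0 \<le> u" "v \<le> b" using uv by auto
    have no_crit: "\<not> (u < x \<and> x < v)" if "x \<in> crit" for x
    proof
      assume x: "u < x \<and> x < v"
      have x0: "poly (pderiv p) x = 0" using that by (simp add: crit_def)
      \<comment> \<open>Monotonicity fixes the sign of the derivative on the piece, so its zero
        \<open>x\<close> is a local extremum of the derivative, and the second derivative vanishes
        there too.\<close>
      have "poly (pderiv (pderiv p)) x = 0"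
        using D(5)[OF J]
      proof
        assume m: "mono_on J (poly p)"
        have "poly (pderiv p) y \<ge> 0" if "u < y" "y < v" for y
          using that uv by (intro mono_on_imp_deriv_nonneg[OF m poly_DERIV]) auto
        then show ?thesis
          by (intro DERIV_local_min[OF poly_DERIV, of "min (x - u) (v - x)"]) (use x x0 in auto)
      next
        assume m: "antimono_on J (poly p)"
        then have m': "mono_on J (poly (- p))" by (auto simp: monotone_on_def)
        have "poly (pderiv (- p)) y \<ge> 0" if "u < y" "y < v" for y
          using that uv by (intro mono_on_imp_deriv_nonneg[OF m' poly_DERIV]) auto
        then have "poly (pderiv p) y \<le> 0" if "u < y" "y < v" for y
          using that by (auto simp: pderiv_minus)
        then show ?thesis
          by (intro DERIV_local_max[OF poly_DERIV, of "min (x - u) (v - x)"]) (use x x0 in auto)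
      qed
      then show False using crit_simple[OF x0] by simp
    qed
    \<comment> \<open>The midpoint selects the lap. A node of that lap inside
      \<open>{u<..<v}\<close> would be a critical point in the interior of the piece.\<close>
    have "(u + v) / 2 \<in> {0..b}" using uv uv' by simp
    then obtain i where i: "i < N" "(u + v) / 2 \<in> lap i" using Union_lap by blast
    have "node i \<le> u"
    proof (cases "i = 0")
      case False
      then have "node i \<in> crit" using i crit_eq by auto
      from no_crit[OF this] i uv show ?thesis by (auto simp: lap_def)
    qed (use uv' in simp)
    moreover have "v \<le> node (Suc i)"
    proof (cases "Suc i = N")
      case False
      then have "node (Suc i) \<in> crit" using i unfolding crit_eq by (intro imageI) auto
      from no_crit[OF this] i uv show ?thesis by (auto simp: lap_def)
    qed (use uv' in simp)
    ultimately show ?thesis using i(1) uv by (auto simp: lap_def)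
  qed
  then obtain f where f: "\<And>J. J \<in> D \<Longrightarrow> f J < N \<and> J \<subseteq> lap (f J)" by metis
  have cover: "interior (lap i) \<subseteq> \<Union>{J \<in> D. f J = i}" if "i < N" for i
  proof
    fix x assume x: "x \<in> interior (lap i)"
    then have "x \<in> {0..b}" using interior_subset Union_lap that by blast
    then obtain J where J: "J \<in> D" "x \<in> J" using D(3) by blast
    have "f J = i" using disj[of i "f J"] f[OF J(1)] x J(2) that by blast
    then show "x \<in> \<Union>{J \<in> D. f J = i}" using J by blast
  qed
  have nonempty: "interior (lap i) \<noteq> {}" if "i < N" for i
    using node_less[of i "Suc i"] that by (simp add: lap_def)
  \<comment> \<open>Every lap has nonempty interior, which only pieces assigned to that lap can
    cover. Surjectivity onto \<open>N\<close> indices from \<open>N\<close> pieces then gives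
    injectivity.\<close>
  have "f ` D = {..<N}"
  proof (intro equalityI subsetI)
    fix i assume i: "i \<in> {..<N}"
    then have "{J \<in> D. f J = i} \<noteq> {}" using cover[of i] nonempty[of i] by auto
    then show "i \<in> f ` D" by blast
  qed (use f in auto)
  then have "inj_on f D" using D(1,2) by (intro eq_card_imp_inj_on) auto
  have "J = lap (f J)" if J: "J \<in> D" for J
  proof
    show "J \<subseteq> lap (f J)" using f[OF J] by simp
    \<comment> \<open>By injectivity the single piece \<open>J\<close> covers the interior of its
      lap; as \<open>J\<close> is closed, it contains the whole lap.\<close>
    have "{J' \<in> D. f J' = f J} = {J}" using \<open>inj_on f D\<close> J by (auto dest: inj_onD)
    with cover[of "f J"] f[OF J] have "interior (lap (f J)) \<subseteq> J" by simp
    moreover have "closed J" using D(4)[OF J] by auto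
    moreover have "closure (interior (lap (f J))) = lap (f J)"
      using node_less[of "f J" "Suc (f J)"] f[OF J] by (simp add: lap_def)
    ultimately show "lap (f J) \<subseteq> J" by (metis closure_minimal)
  qed
  then have "D = lap ` f ` D" by (force simp: image_image)
  with \<open>f ` D = {..<N}\<close> show "D = lap ` {..<N}" by simp
qed

lemma base_interval_eq:
  assumes "degree R = N" and "julia_hull R = {0..b}" and "real_map R = poly p"
  shows "base_interval R = (\<Inter>i<N. poly p ` lap i)"
proof -
  have "lap_decomposition R = lap ` {..<N}"
    unfolding lap_decomposition_def is_lap_image_iff[OF assms] by simp
  then show ?thesis by (simp add: base_interval_def assms(3))
qed

section \<open>Behaviour on the first lap\<close>

lemma pderiv_pos_first_lap: "0 < t \<Longrightarrow> t < node 1 \<Longrightarrow> poly (pderiv p) t > 0"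
proof -
  assume t: "0 < t" "t < node 1"
  have less: "0 < node 1" using t by simp
  have "\<not> (\<forall>t. 0 < t \<longrightarrow> t < node 1 \<longrightarrow> poly (pderiv p) t < 0)"
  proof
    assume "\<forall>t. 0 < t \<longrightarrow> t < node 1 \<longrightarrow> poly (pderiv p) t < 0"
    then have "poly (- pderiv p) 0 \<ge> 0"
      by (intro poly_nonneg_at_ends(1)[OF less]) auto
    then show False using deriv_0 by simp
  qed
  then show ?thesis using pderiv_sign_on_lap[of 0] N t by auto
qed

lemma p_pos_first_lap: "0 < t \<Longrightarrow> t \<le> node 1 \<Longrightarrow> poly p t > 0"
proof -
  assume t: "0 < t" "t \<le> node 1"
  have "poly p 0 < poly p t"
    using t(1)
  proof (rule DERIV_pos_imp_increasing_open)
    fix u assume "0 < u" "u < t"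
    then show "\<exists>y. (poly p has_real_derivative y) (at u) \<and> 0 < y"
      using pderiv_pos_first_lap[of u] t by (intro exI[of _ "poly (pderiv p) u"]) (auto intro: poly_DERIV)
  qed (intro continuous_intros)
  then show ?thesis by (simp add: p_0)
qed

lemma node_1: "0 < node 1" "node 1 < b"
  using node_less[of 0 1] node_less[of 1 N] N by simp_all

text \<open>Write \<open>p = x q\<close>. On the first lap \<open>q\<close> decreases from
  \<open>p' 0\<close>, because all its roots lie further right, and stays above 1 up to
  \<open>node 1\<close>. The constant \<kappa> is the value of \<open>q\<close> at
  \<open>node 1\<close>, and \<open>K\<close> bounds the derivative of \<open>q\<close>.\<close>

lemma first_lap_bounds:
  obtains \<kappa> K where "\<kappa> > 1" "K \<ge> 0"
    "\<And>x. x \<in> lap 0 \<Longrightarrow> \<kappa> * x \<le> poly p x"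
    "\<And>x. x \<in> lap 0 \<Longrightarrow> poly p x \<le> poly (pderiv p) 0 * x"
    "\<And>x. x \<in> lap 0 \<Longrightarrow> poly (pderiv p) 0 * x \<le> (1 + K * x) * poly p x"
proof -
  have "0 \<in># A" using p_0 poly_poly_of_roots_eq_0_iff[OF p_A(2), of A 0] p_A(1) by simp
  then obtain A0 where A0: "A = add_mset 0 A0" by (meson multi_member_split)
  define q where "q = poly_of_roots a A0"
  have p: "p = pCons 0 q" by (simp add: p_A(1) A0 q_def poly_of_roots_add_mset)
  have px: "poly p x = x * poly q x" for x by (simp add: p)
  have q0: "poly q 0 = poly (pderiv p) 0" by (simp add: p pderiv_pCons)
  have q_pos: "poly q x > 0" if "0 \<le> x" "x \<le> node 1" for x
  proof (cases "x = 0")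
    case False
    then have "0 < x * poly q x" using p_pos_first_lap[of x] that by (simp add: px)
    then show ?thesis using that by (simp add: zero_less_mult_iff)
  qed (use q0 deriv_0 in simp)
  \<comment> \<open>The roots of \<open>p\<close> are nonnegative and \<open>q\<close> is positive
    on the whole first lap, 0 included.\<close>
  have root_gt: "node 1 < r" if "r \<in># A0" for r
  proof (rule ccontr)
    assume "\<not> node 1 < r"
    moreover have "0 \<le> r" using that p_A(4) by (auto simp: A0)
    moreover have "poly q r = 0" using that p_A(2) by (simp add: q_def poly_poly_of_roots_eq_0_iff)
    ultimately show False using q_pos[of r] by simp
  qed
  have A0_nonempty: "A0 \<noteq> {#}" using p_A(3) N by (auto simp: A0)
  have dq: "poly (pderiv q) x \<le> 0" if "0 \<le> x" "x \<le> node 1" for x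
    using pderiv_poly_of_roots_neg[OF A0_nonempty p_A(2), of x] root_gt q_pos[OF that] that
    unfolding q_def[symmetric] by (force simp: mult_less_0_iff)
  have anti: "poly q y \<le> poly q x" if "0 \<le> x" "x \<le> y" "y \<le> node 1" for x y
    using that(2)
  proof (rule DERIV_nonpos_imp_nonincreasing)
    fix t assume "x \<le> t" "t \<le> y"
    then show "\<exists>y. (poly q has_real_derivative y) (at t) \<and> y \<le> 0"
      using dq[of t] that by (intro exI[of _ "poly (pderiv q) t"]) (auto intro: poly_DERIV)
  qed
  have "compact (poly (pderiv q) ` {0..node 1})"
    by (intro compact_continuous_image continuous_intros) simp
  then obtain K where K: "\<And>x. 0 \<le> x \<Longrightarrow> x \<le> node 1 \<Longrightarrow> \<bar>poly (pderiv q) x\<bar> \<le> K"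
    using compact_imp_bounded[unfolded bounded_iff] by (fastforce simp: bounded_iff)
  have K0: "K \<ge> 0" using K[of 0] node_1 by force
  have lip: "poly q 0 - poly q x \<le> K * x" if "0 \<le> x" "x \<le> node 1" for x
  proof (cases "x = 0")
    case False
    then have "0 < x" using that by simp
    from poly_MVT[OF this, of q]
    obtain z where z: "0 < z" "z < x" "poly q x - poly q 0 = (x - 0) * poly (pderiv q) z" by blast
    have "- poly (pderiv q) z \<le> K" using K[of z] z that by auto
    then have "x * - poly (pderiv q) z \<le> x * K" using that by (intro mult_left_mono) auto
    then show ?thesis using z(3) by (simp add: mult.commute)
  qed simp
  \<comment> \<open>The first lap reaches at least the height \<open>b\<close>, while
    \<open>node 1 < b\<close>; the quotient therefore exceeds 1.\<close>
  define \<kappa> where "\<kappa> = poly q (node 1)"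
  have "b \<le> poly p (node (Suc 0))"
    using N pderiv_pos_first_lap by (intro increasing_lap(2)) auto
  then have "b \<le> node 1 * \<kappa>" by (simp add: \<kappa>_def px)
  then have "node 1 < node 1 * \<kappa>" using node_1 by linarith
  then have \<kappa>: "\<kappa> > 1" using node_1 by simp
  show ?thesis
  proof (rule that[OF \<kappa> K0])
    fix x assume "x \<in> lap 0"
    then have x: "0 \<le> x" "x \<le> node 1" by (auto simp: lap_def)
    show "\<kappa> * x \<le> poly p x"
      using mult_left_mono[OF anti[of x "node 1"], of x] x by (simp add: \<kappa>_def px mult.commute anti)
    show "poly p x \<le> poly (pderiv p) 0 * x"
      using mult_left_mono[OF anti[of 0 x], of x] x by (simp add: q0[symmetric] px mult.commute)
    \<comment> \<open>This turns the additive bound \<open>q 0 \<le> q x + K * x\<close> into a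
      multiplicative one.\<close>
    have "1 \<le> poly q x" using anti[of x "node 1"] x \<kappa> by (simp add: \<kappa>_def)
    then have "K * x * 1 \<le> K * x * poly q x" using K0 x by (intro mult_left_mono) auto
    then have "poly q 0 \<le> (1 + K * x) * poly q x" using lip[OF x] by (simp add: algebra_simps)
    then have "x * poly q 0 \<le> x * ((1 + K * x) * poly q x)" using x by (intro mult_left_mono) auto
    then show "poly (pderiv p) 0 * x \<le> (1 + K * x) * poly p x"
      by (simp add: q0[symmetric] px ac_simps)
  qed
qed

section \<open>Preimages of the points of the base interval\<close>

definition core :: "real set" where "core = (\<Inter>i<N. poly p ` lap i)"

lemma hull_subset_core: "{0..b} \<subseteq> core"
  unfolding core_def using lap_image by blast

lemma core_nonneg: "w \<in> core \<Longrightarrow> w \<ge> 0"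
proof -
  assume "w \<in> core"
  then obtain x where x: "x \<in> lap 0" "w = poly p x" using N by (force simp: core_def)
  show "w \<ge> 0"
  proof (cases "x = 0")
    case False
    then show ?thesis using p_pos_first_lap[of x] x by (auto simp: lap_def)
  qed (use x p_0 in simp)
qed

(* A point common to two laps is a critical point, hence a root of multiplicity at least two. *)
lemma card_laps_le_order:
  assumes x: "\<And>i. i < N \<Longrightarrow> x i \<in> lap i" "\<And>i. i < N \<Longrightarrow> poly p (x i) = w"
  defines "P \<equiv> cpoly p - [:of_real w:]"
  shows "card {i \<in> {..<N}. x i = v} \<le> order (of_real v) P"
proof (cases "{i \<in> {..<N}. x i = v} = {}")
  case False
  define C where "C = {i \<in> {..<N}. x i = v}"
  have C: "finite C" "C \<noteq> {}" using False by (auto simp: C_def)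
  define i where "i = Min C"
  have i: "i \<in> C" "i < N" "x i = v" using Min_in[OF C] by (auto simp: i_def C_def)
  have P0: "P \<noteq> 0"
  proof
    assume "P = 0"
    then have "degree (cpoly p) = 0" unfolding P_def by simp
    then show False using degree_p N by simp
  qed
  have root: "poly P (of_real v) = 0" using x(2)[OF i(2)] i(3) by (simp add: P_def)
  have ord: "order (of_real v) P = Suc (order (of_real v) (pderiv P))"
    by (rule order_pderiv[OF P0 root])
  \<comment> \<open>Of the later laps only the adjacent one can share the point \<open>v\<close>,
    and then \<open>v\<close> is the common node.\<close>
  have next_lap: "j = Suc i \<and> v = node (Suc i)" if "j \<in> C" "j \<noteq> i" for j
  proof -
    have "i \<le> j" using Min_le[OF C(1) that(1)] by (simp add: i_def)
    with that have j: "Suc i \<le> j" "j < N" "x j = v" by (auto simp: C_def)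
    have "v \<le> node (Suc i)" using x(1)[OF i(2)] i(3) by (simp add: lap_def)
    moreover have "node j \<le> v" using x(1)[OF j(2)] j(3) by (simp add: lap_def)
    ultimately have "\<not> node (Suc i) < node j" "v \<le> node (Suc i)" "node j \<le> v" by auto
    then have "j = Suc i" using node_less[of "Suc i" j] j by linarith
    with \<open>v \<le> node (Suc i)\<close> \<open>node j \<le> v\<close> show ?thesis by simp
  qed
  show ?thesis
  proof (cases "C = {i}")
    case True
    then show ?thesis unfolding C_def[symmetric] ord by simp
  next
    case False
    then obtain j where j: "j \<in> C" "j \<noteq> i" using i(1) by blast
    have "C \<subseteq> {i, Suc i}" using next_lap by blast
    then have "card C \<le> card {i, Suc i}" by (intro card_mono) auto
    then have "card C \<le> 2" by simp
    moreover have "order (of_real v) (pderiv P) \<noteq> 0"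
    proof -
      have *: "pderiv P = cpoly (pderiv p)" by (simp add: P_def pderiv_diff pderiv_pCons pderiv_cpoly)
      have "Suc i < N" using next_lap[OF j] j by (auto simp: C_def)
      then have "v \<in> crit" using next_lap[OF j] unfolding crit_eq by auto
      then have "poly (pderiv P) (of_real v) = 0" by (simp add: * crit_def)
      moreover have "pderiv P \<noteq> 0" using cpoly_eq_iff[of "pderiv p" 0] deriv_0 by (auto simp: *)
      ultimately show ?thesis using order_root by blast
    qed
    ultimately show ?thesis unfolding C_def[symmetric] ord by simp
  qed
qed (metis card.empty le0)

text \<open>One preimage from each lap gives \<open>N\<close> roots, and by degree there are no
  more. The first is singled out because it alone can be close to 0; the others are at least
  \<open>node 1\<close>.\<close>

lemma proots_split:
  assumes "w \<in> core"
  shows "\<exists>x0 A'. proots (cpoly p - [:of_real w:]) = image_mset of_real (add_mset x0 A') \<and>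
    x0 \<in> lap 0 \<and> poly p x0 = w \<and> set_mset A' \<subseteq> {node 1..b} \<and> size A' = N - 1"
proof -
  define P where "P = cpoly p - [:of_real w:]"
  have "\<exists>x. x \<in> lap i \<and> poly p x = w" if "i < N" for i
    using assms that by (force simp: core_def)
  then obtain x where x: "\<And>i. i < N \<Longrightarrow> x i \<in> lap i" "\<And>i. i < N \<Longrightarrow> poly p (x i) = w" by metis
  define M where "M = image_mset x (mset_set {..<N})"
  have "degree (cpoly p + - [:of_real w:]) = degree (cpoly p)"
    using degree_p N by (intro degree_add_eq_left) simp
  then have deg: "degree P = N" by (simp only: P_def degree_p diff_conv_add_uminus degree_cpoly)
  have count_M: "count M v = card {i \<in> {..<N}. x i = v}" for v
  proof -
    have "count M v = (\<Sum>i\<in>x -` {v} \<inter> {..<N}. count (mset_set {..<N}) i)"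
      by (simp add: M_def count_image_mset)
    also have "\<dots> = (\<Sum>i\<in>x -` {v} \<inter> {..<N}. 1)" by (intro sum.cong) auto
    also have "x -` {v} \<inter> {..<N} = {i \<in> {..<N}. x i = v}" by auto
    finally show ?thesis by simp
  qed
  \<comment> \<open>A preimage chosen in two adjacent laps must be at least a double root;
    \<open>card_laps_le_order\<close> supplies this.\<close>
  have "image_mset of_real M \<subseteq># proots P"
  proof (rule mset_subset_eqI)
    fix z :: complex
    show "count (image_mset of_real M) z \<le> count (proots P) z"
    proof (cases "z \<in> range of_real")
      case True
      then obtain v where v: "z = of_real v" by blast
      have "count (image_mset of_real M) z = count M v"
        by (cases "v \<in># M") (auto simp: v count_image_mset vimage_def not_in_iff)
      moreover have "P \<noteq> 0" using deg N by auto
      ultimately show ?thesis using card_laps_le_order[of x w v] x by (simp add: v count_M P_def)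
    next
      case False
      then have "z \<notin># image_mset of_real M" by auto
      then have "count (image_mset of_real M) z = 0" by (subst count_eq_zero_iff)
      then show ?thesis by simp
    qed
  qed
  moreover have "size (image_mset of_real M) = size (proots P)"
    by (simp add: M_def size_proots_complex deg)
  ultimately have "proots P = image_mset of_real M"
    using mset_subset_size[of "image_mset of_real M" "proots P"] by (auto simp: subset_mset.le_less)
  moreover have "{..<N} = insert 0 {1..<N}" using N by auto
  then have "M = add_mset (x 0) (image_mset x (mset_set {1..<N}))" by (simp add: M_def)
  moreover have "node 1 \<le> x i \<and> x i \<le> b" if "1 \<le> i" "i < N" for i
    using x(1)[OF that(2)] node_le[of 1 i] node_le[of "Suc i" N] that by (auto simp: lap_def)
  then have "set_mset (image_mset x (mset_set {1..<N})) \<subseteq> {node 1..b}" by auto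
  ultimately show ?thesis
    using x[of 0] N
    by (intro exI[of _ "x 0"] exI[of _ "image_mset x (mset_set {1..<N})"]) (auto simp: P_def)
qed

end

section \<open>From the Julia set to a real polynomial\<close>

lemma real_proots:
  fixes P :: "complex poly"
  assumes "P \<noteq> 0" and "\<And>z. poly P z = 0 \<Longrightarrow> z \<in> complex_of_real ` {0..b}"
  obtains A where "proots P = image_mset of_real A" "set_mset A \<subseteq> {0..b}"
    "P = poly_of_roots (lead_coeff P) (image_mset of_real A)"
proof -
  define A where "A = image_mset Re (proots P)"
  have root: "z = of_real (Re z) \<and> Re z \<in> {0..b}" if "z \<in># proots P" for z
  proof -
    have "poly P z = 0" using that assms(1) by simp
    from assms(2)[OF this] show ?thesis by auto
  qed
  have "image_mset of_real A = image_mset id (proots P)"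
    unfolding A_def image_mset.compositionality using root by (intro image_mset_cong) (metis comp_apply id_apply)
  then have *: "proots P = image_mset of_real A" by simp
  show ?thesis
  proof (rule that[OF *])
    show "set_mset A \<subseteq> {0..b}" using root by (auto simp: A_def)
    show "P = poly_of_roots (lead_coeff P) (image_mset of_real A)"
      unfolding poly_of_roots_def *[symmetric] by (rule complex_poly_decompose_multiset[symmetric])
  qed
qed

lemma poly_of_roots_pderiv_factor:
  "pderiv (poly_of_roots (a * k) A) = smult a (pderiv (poly_of_roots k A))"
  by (simp add: poly_of_roots_def pderiv_smult mult.assoc)

text \<open>Since 0 and \<open>b\<close> are Julia points, backward invariance puts all roots of
  \<open>R\<close> and of \<open>R - b\<close> into \<open>{0..b}\<close>. Real roots make
  \<open>R\<close> real up to its leading coefficient, and that is real because \<open>R' 0\<close>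
  is.\<close>

lemma full_lap_poly_of_julia:
  fixes R :: "complex poly" and N :: nat and c :: real
  assumes "degree R = N" and "N \<ge> 2" and "poly R 0 = 0"
    and "poly (pderiv R) 0 = of_real c" and "c > 1"
    and "julia_set R \<subseteq> complex_of_real ` {0..}"
  obtains p b a a' A B where "R = cpoly p" "full_lap_poly p N b a a' A B" "julia_hull R = {0..b}"
proof -
  have deg: "degree R \<ge> 2" "degree R > 0" using assms(1,2) by auto
  have "0 \<in> julia_set R"
    using repelling_fixpoint_in_julia_set[of R 0] assms(3-5) by simp
  then obtain b where b: "julia_hull R = {0..b}" "b \<ge> 0" "of_real b \<in> julia_set R"
    "julia_set R \<subseteq> complex_of_real ` {0..b}"
    using julia_hull_eq[OF deg(1) _ assms(6)] by metis
  have real_root: "z \<in> complex_of_real ` {0..b}" if "poly R z \<in> julia_set R" for z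
    using julia_set_backward[OF deg(2) that] b(4) by blast
  have "R \<noteq> 0" using deg by auto
  then obtain A where A: "proots R = image_mset of_real A" "set_mset A \<subseteq> {0..b}"
    "R = poly_of_roots (lead_coeff R) (image_mset of_real A)"
    using real_proots[of R b] real_root \<open>0 \<in> julia_set R\<close> by metis
  \<comment> \<open>The derivative at 0 of the monic polynomial with the same roots;
    \<open>c\<close> is the leading coefficient times this real number.\<close>
  define m where "m = poly (pderiv (poly_of_roots 1 A)) 0"
  have "R = poly_of_roots (lead_coeff R * of_real 1) (image_mset of_real A)" using A(3) by simp
  then have "pderiv R = smult (lead_coeff R) (pderiv (cpoly (poly_of_roots 1 A)))"
    using poly_of_roots_pderiv_factor[of "lead_coeff R" "of_real 1"] by (metis cpoly_poly_of_roots)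
  then have "of_real c = lead_coeff R * of_real m"
    using assms(4) poly_cpoly[of "pderiv (poly_of_roots 1 A)" 0] by (simp add: m_def pderiv_cpoly)
  moreover have "m \<noteq> 0" using calculation assms(5) by auto
  ultimately have lead: "lead_coeff R = of_real (c / m)" by (simp add: field_simps)
  define a where "a = c / m"
  have "a \<noteq> 0" using \<open>m \<noteq> 0\<close> assms(5) by (simp add: a_def)
  define p where "p = poly_of_roots a A"
  have R: "R = cpoly p" unfolding p_def cpoly_poly_of_roots using A(3) lead by (simp add: a_def)
  have deg_p: "degree p = N" using R assms(1) by simp
  have size_A: "size A = N" using degree_poly_of_roots[OF \<open>a \<noteq> 0\<close>, of A] deg_p by (simp add: p_def)
  have p0: "poly p 0 = 0" using assms(3) poly_cpoly[of p 0] by (simp add: R)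
  have dp0: "poly (pderiv p) 0 = c" using assms(4) poly_cpoly[of "pderiv p" 0] by (simp add: R pderiv_cpoly)
  have "b > 0"
  proof (rule ccontr)
    \<comment> \<open>Then 0 would be the only root, of multiplicity at least 2, and the derivative
      would vanish there.\<close>
    assume "\<not> b > 0"
    then have zero: "r = 0" if "r \<in># A" for r using A(2) b(2) that by force
    have "2 \<le> size A" using size_A assms(2) by simp
    then obtain r A1 where A1: "A = add_mset r A1" "A1 \<noteq> {#}"
      by (cases A) fastforce+
    then obtain r' A2 where A2: "A1 = add_mset r' A2" by (meson multiset_cases)
    have "r = 0" "r' = 0" using zero A1 A2 by auto
    then have "poly (pderiv p) 0 = 0"
      unfolding p_def A1(1) pderiv_poly_of_roots_add_mset A2 by (simp add: poly_of_roots_add_mset)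
    then show False using dp0 assms(5) by simp
  qed
  have "degree (p + - [:b:]) = degree p"
    using deg_p assms(2) by (intro degree_add_eq_left) simp
  then have deg_b: "degree (p - [:b:]) = N" by (simp only: deg_p diff_conv_add_uminus)
  have "poly (cpoly (p - [:b:])) z = 0 \<Longrightarrow> z \<in> complex_of_real ` {0..b}" for z
    using real_root[of z] b(3) by (simp add: cpoly_diff cpoly_const R)
  moreover have "cpoly (p - [:b:]) \<noteq> 0" using deg_b assms(2) degree_cpoly[of "p - [:b:]"] by force
  ultimately obtain B where B: "set_mset B \<subseteq> {0..b}"
    "cpoly (p - [:b:]) = poly_of_roots (lead_coeff (cpoly (p - [:b:]))) (image_mset of_real B)"
    using real_proots[of "cpoly (p - [:b:])" b] by metis
  have "lead_coeff (cpoly (p - [:b:])) = of_real (lead_coeff (p - [:b:]))"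
    by (simp add: coeff_map_poly)
  then have "cpoly (p - [:b:]) = cpoly (poly_of_roots (lead_coeff (p - [:b:])) B)"
    using B(2) by (simp only: cpoly_poly_of_roots)
  then have pB: "p - [:b:] = poly_of_roots (lead_coeff (p - [:b:])) B" by (simp only: cpoly_eq_iff)
  have "full_lap_poly p N b a (lead_coeff (p - [:b:])) A B"
  proof
    show "p - [:b:] = poly_of_roots (lead_coeff (p - [:b:])) B" by (rule pB)
    show "lead_coeff (p - [:b:]) \<noteq> 0"
      using deg_b assms(2) by (metis degree_0 leading_coeff_0_iff not_numeral_le_zero)
  qed (use assms(2,5) \<open>b > 0\<close> \<open>a \<noteq> 0\<close> size_A A(2) B(1) p0 dp0 in \<open>auto simp: p_def\<close>)
  with R b(1) show ?thesis by (intro that)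
qed

section \<open>Sums over the tree of preimages\<close>

lemma image_mset_sum: "image_mset f (\<Sum>i\<in>A. g i) = (\<Sum>i\<in>A. image_mset f (g i))"
  by (induction A rule: infinite_finite_induct) auto

lemma filter_mset_sum: "filter_mset P (\<Sum>i\<in>A. g i) = (\<Sum>i\<in>A. filter_mset P (g i))"
  by (induction A rule: infinite_finite_induct) auto

lemma sum_mset_sum_mset: "sum_mset (\<Sum>i\<in>A. g i) = (\<Sum>i\<in>A. sum_mset (g i))"
  by (induction A rule: infinite_finite_induct) auto

lemma tendsto_sum_mset:
  fixes g :: "'a \<Rightarrow> 'b \<Rightarrow> 'c::topological_comm_monoid_add"
  shows "(\<And>x. x \<in># M \<Longrightarrow> ((\<lambda>n. g n x) \<longlongrightarrow> h x) F) \<Longrightarrow>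
    ((\<lambda>n. \<Sum>x\<in>#M. g n x) \<longlongrightarrow> (\<Sum>x\<in>#M. h x)) F"
  by (induction M) (auto intro: tendsto_add)

lemma norm_sum_mset:
  fixes g :: "'a \<Rightarrow> 'b::real_normed_vector"
  shows "norm (\<Sum>x\<in>#M. g x) \<le> (\<Sum>x\<in>#M. norm (g x))"
  by (induction M) (auto intro: norm_triangle_le)

lemma sum_mset_le_size_times:
  fixes g :: "'a \<Rightarrow> real"
  shows "(\<And>x. x \<in># M \<Longrightarrow> g x \<le> B) \<Longrightarrow> (\<Sum>x\<in>#M. g x) \<le> real (size M) * B"
proof (induction M)
  case (add x M)
  then have "(\<Sum>x\<in>#M. g x) \<le> real (size M) * B" "g x \<le> B" by auto
  then show ?case by (simp add: algebra_simps)
qed simp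

lemma holomorphic_on_sum_mset:
  "(\<And>x. x \<in># M \<Longrightarrow> g x holomorphic_on S) \<Longrightarrow> (\<lambda>s. \<Sum>x\<in>#M. g x s) holomorphic_on S"
  by (induction M) (auto intro: holomorphic_on_add)

lemma norm_of_real_powr: "x > 0 \<Longrightarrow> norm (complex_of_real x powr z) = x powr Re z"
  by (simp add: norm_powr_real_powr)

(* Ties are broken by the index, so that every element of I has finitely many predecessors
   and its rank is the number of these. *)
lemma ex_incseq_enumeration:
  fixes f :: "'i::countable \<Rightarrow> real"
  assumes I: "infinite I" and fin: "\<And>B. finite {i \<in> I. f i \<le> B}"
  obtains h where "bij_betw h (UNIV :: nat set) I" "incseq (f \<circ> h)"
proof -
  define pred where "pred i = {j \<in> I. f j < f i \<or> f j = f i \<and> to_nat j < to_nat i}" for i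
  define rank where "rank i = card (pred i)" for i
  have fin_pred: "finite (pred i)" for i
    by (rule finite_subset[OF _ fin[of "f i"]]) (auto simp: pred_def)
  have rank_less: "rank j < rank i" if "j \<in> pred i" for i j
    unfolding rank_def
  proof (rule psubset_card_mono[OF fin_pred])
    have "pred j \<subseteq> pred i" "j \<notin> pred j" using that by (auto simp: pred_def)
    with that show "pred j \<subset> pred i" by blast
  qed
  have total: "i = j \<or> i \<in> pred j \<or> j \<in> pred i" if "i \<in> I" "j \<in> I" for i j
    by (cases "f i" "f j" rule: linorder_cases; cases "to_nat i" "to_nat j" rule: linorder_cases)
       (use that in \<open>auto simp: pred_def\<close>)
  have inj: "inj_on rank I"
    using total rank_less by (metis inj_onI less_irrefl)
  \<comment> \<open>The \<open>rank i\<close> predecessors have distinct ranks below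
    \<open>rank i\<close>, so these fill all places below it.\<close>
  have down: "{..<rank i} \<subseteq> rank ` I" for i
  proof -
    have "pred i \<subseteq> I" by (auto simp: pred_def)
    then have "card (rank ` pred i) = card (pred i)"
      by (intro card_image inj_on_subset[OF inj])
    then have "card (rank ` pred i) = card {..<rank i}" by (simp add: rank_def)
    moreover have "rank ` pred i \<subseteq> {..<rank i}" using rank_less by auto
    ultimately have "rank ` pred i = {..<rank i}" by (intro card_subset_eq) auto
    with \<open>pred i \<subseteq> I\<close> show ?thesis by blast
  qed
  have "n \<in> rank ` I" for n
  proof -
    have "infinite (rank ` I)" using I inj by (simp add: finite_image_iff)
    then obtain i where "rank i > n" by (metis (mono_tags, lifting) image_iff infinite_nat_iff_unbounded)
    then show ?thesis using down[of i] by auto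
  qed
  then have bij: "bij_betw rank I UNIV" using inj by (auto simp: bij_betw_def)
  define h where "h = inv_into I rank"
  have h: "bij_betw h UNIV I" unfolding h_def using bij by (rule bij_betw_inv_into)
  have h_rank: "h n \<in> I" "rank (h n) = n" for n
    using bij by (auto simp: h_def bij_betw_def inv_into_into f_inv_into_f)
  have "f (h m) \<le> f (h n)" if "m \<le> n" for m n
  proof (rule ccontr)
    assume "\<not> ?thesis"
    then have "h n \<in> pred (h m)" using h_rank by (auto simp: pred_def)
    then show False using rank_less[of "h n" "h m"] h_rank(2) that by simp
  qed
  then have "incseq (f \<circ> h)" by (auto simp: incseq_def)
  with h show ?thesis by (rule that)
qed

text \<open>An abstract tree of preimages: \<phi> is the inverse branch into the first lap and
  \<open>A w\<close> collects the other preimages, which stay above \<delta>. The alternative for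
  \<open>z0\<close> lets a nonzero root of the tree satisfy the same lower bound.\<close>

locale preimage_tree =
  fixes \<phi> :: "real \<Rightarrow> real" and A :: "real \<Rightarrow> real multiset" and S :: "real set"
    and c \<kappa> K \<delta> z0 :: real and N :: nat
  assumes c: "c > 1" and \<kappa>: "\<kappa> > 1" and K: "K \<ge> 0" and \<delta>: "\<delta> > 0" "\<delta> \<le> 1" and N: "N \<ge> 2"
    and z0: "z0 \<in> S" "z0 = 0 \<or> \<delta> \<le> z0"
    and S_nonneg: "w \<in> S \<Longrightarrow> w \<ge> 0"
    and \<phi>: "w \<in> S \<Longrightarrow> \<phi> w \<in> S" "w \<in> S \<Longrightarrow> \<kappa> * \<phi> w \<le> w" "w \<in> S \<Longrightarrow> w \<le> c * \<phi> w"
      "w \<in> S \<Longrightarrow> c * \<phi> w \<le> (1 + K * \<phi> w) * w"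
    and A: "w \<in> S \<Longrightarrow> set_mset (A w) \<subseteq> S \<inter> {\<delta>..}" "w \<in> S \<Longrightarrow> size (A w) = N - 1"
begin

section \<open>Rescaled iterates of the branch at 0\<close>

lemma funpow_\<phi>: "w \<in> S \<Longrightarrow> (\<phi> ^^ m) w \<in> S"
  by (induction m) (auto intro: \<phi>(1))

lemma funpow_\<phi>_le: "w \<in> S \<Longrightarrow> (\<phi> ^^ m) w \<le> w * (1 / \<kappa>) ^ m"
proof (induction m)
  case (Suc m)
  have "\<phi> ((\<phi> ^^ m) w) \<le> (\<phi> ^^ m) w / \<kappa>"
    using \<phi>(2)[OF funpow_\<phi>[OF Suc.prems]] \<kappa> by (simp add: field_simps)
  also have "\<dots> \<le> w * (1 / \<kappa>) ^ m / \<kappa>" using Suc \<kappa> by (intro divide_right_mono) auto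
  finally show ?case by simp
qed simp

text \<open>Hence the omission of 0 from a level can be decided before any power of \<phi> is
  applied.\<close>

lemma \<phi>_eq_0_iff: "w \<in> S \<Longrightarrow> \<phi> w = 0 \<longleftrightarrow> w = 0"
proof -
  assume w: "w \<in> S"
  then have "0 \<le> \<phi> w" using S_nonneg \<phi>(1) by blast
  moreover have "\<phi> w \<le> \<kappa> * \<phi> w" using \<kappa> calculation by (simp add: mult_le_cancel_right1)
  ultimately show ?thesis using \<phi>(2)[OF w] \<phi>(3)[OF w] S_nonneg[OF w] by auto
qed

lemma funpow_\<phi>_eq_0_iff: "w \<in> S \<Longrightarrow> (\<phi> ^^ m) w = 0 \<longleftrightarrow> w = 0"
  by (induction m) (auto simp: \<phi>_eq_0_iff funpow_\<phi>)

definition scaled :: "real \<Rightarrow> nat \<Rightarrow> real" where "scaled w m = c ^ m * (\<phi> ^^ m) w"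

text \<open>In the application this is the Koenigs linearisation of the inverse branch at its fixed
  point 0, whose multiplier is \<open>1 / c\<close>.\<close>

definition limval :: "real \<Rightarrow> real" where "limval w = lim (scaled w)"

lemma scaled_mono: "w \<in> S \<Longrightarrow> incseq (scaled w)"
proof (rule incseq_SucI)
  fix m assume w: "w \<in> S"
  have "c ^ m * (\<phi> ^^ m) w \<le> c ^ m * (c * \<phi> ((\<phi> ^^ m) w))"
    using \<phi>(3)[OF funpow_\<phi>[OF w]] c by (intro mult_left_mono) auto
  then show "scaled w m \<le> scaled w (Suc m)" by (simp add: scaled_def ac_simps)
qed

text \<open>Each step multiplies the scaled value by at most \<open>1 + K * \<phi> v\<close>, and
  contraction makes these corrections decay geometrically. The exponential collects them into a
  convergent sum.\<close>

lemma scaled_le_exp: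
  assumes w: "w \<in> S"
  shows "scaled w m \<le> w * exp (K * w * (\<Sum>j<m. (1 / \<kappa>) ^ j))"
proof (induction m)
  case (Suc m)
  define v where "v = (\<phi> ^^ m) w"
  have v: "v \<in> S" using funpow_\<phi>[OF w] by (simp add: v_def)
  have v0: "0 \<le> v" "0 \<le> \<phi> v" using S_nonneg v \<phi>(1) by auto
  have "\<phi> v \<le> \<kappa> * \<phi> v" using mult_right_mono[of 1 \<kappa> "\<phi> v"] \<kappa> v0 by simp
  also have "\<dots> \<le> v" by (rule \<phi>(2)[OF v])
  also have "\<dots> \<le> w * (1 / \<kappa>) ^ m" unfolding v_def by (rule funpow_\<phi>_le[OF w])
  finally have "K * \<phi> v \<le> K * (w * (1 / \<kappa>) ^ m)" using K by (rule mult_left_mono)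
  moreover have "1 + K * (w * (1 / \<kappa>) ^ m) \<le> exp (K * (w * (1 / \<kappa>) ^ m))" by (rule exp_ge_add_one_self)
  ultimately have "1 + K * \<phi> v \<le> exp (K * w * (1 / \<kappa>) ^ m)" unfolding mult.assoc by linarith
  then have "(1 + K * \<phi> v) * v \<le> exp (K * w * (1 / \<kappa>) ^ m) * v" using v0 by (intro mult_right_mono)
  with \<phi>(4)[OF v] have "c * \<phi> v \<le> exp (K * w * (1 / \<kappa>) ^ m) * v" by linarith
  then have "c ^ m * (c * \<phi> v) \<le> c ^ m * (exp (K * w * (1 / \<kappa>) ^ m) * v)"
    using c by (intro mult_left_mono) auto
  then have "scaled w (Suc m) \<le> exp (K * w * (1 / \<kappa>) ^ m) * scaled w m"
    by (simp add: scaled_def v_def ac_simps)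
  also have "\<dots> \<le> exp (K * w * (1 / \<kappa>) ^ m) * (w * exp (K * w * (\<Sum>j<m. (1 / \<kappa>) ^ j)))"
    using Suc.IH by (intro mult_left_mono) auto
  also have "\<dots> = w * exp (K * w * (\<Sum>j<Suc m. (1 / \<kappa>) ^ j))"
    by (simp add: exp_add[symmetric] algebra_simps)
  finally show ?case .
qed (simp add: scaled_def)

lemma
  assumes w: "w \<in> S"
  shows scaled_tendsto: "scaled w \<longlonglongrightarrow> limval w" and scaled_le_limval: "scaled w m \<le> limval w"
proof -
  have "scaled w m \<le> w * exp (K * w * (1 / (1 - 1 / \<kappa>)))" for m
  proof -
    have "(\<Sum>j<m. (1 / \<kappa>) ^ j) \<le> (\<Sum>j. (1 / \<kappa>) ^ j)"
      using \<kappa> by (intro sum_le_suminf summable_geometric) auto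
    also have "\<dots> = 1 / (1 - 1 / \<kappa>)" using \<kappa> by (intro suminf_geometric) auto
    finally have "K * w * (\<Sum>j<m. (1 / \<kappa>) ^ j) \<le> K * w * (1 / (1 - 1 / \<kappa>))"
      using K S_nonneg[OF w] by (intro mult_left_mono) auto
    then have "w * exp (K * w * (\<Sum>j<m. (1 / \<kappa>) ^ j)) \<le> w * exp (K * w * (1 / (1 - 1 / \<kappa>)))"
      using S_nonneg[OF w] by (intro mult_left_mono) auto
    with scaled_le_exp[OF w, of m] show ?thesis by linarith
  qed
  then have "convergent (scaled w)"
    using incseq_convergent[OF scaled_mono[OF w]] by (metis convergent_def)
  then show lim: "scaled w \<longlonglongrightarrow> limval w" unfolding limval_def by (simp add: convergent_LIMSEQ_iff)
  show "scaled w m \<le> limval w" using incseq_le[OF scaled_mono[OF w] lim] .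
qed

lemma le_scaled: "w \<in> S \<Longrightarrow> w \<le> scaled w m"
  using incseqD[OF scaled_mono, of w 0 m] by (simp add: scaled_def)

lemma le_limval: "w \<in> S \<Longrightarrow> w \<le> limval w"
  using scaled_le_limval[of w 0] by (simp add: scaled_def)

section \<open>Levels of the tree and generations\<close>

primrec level :: "nat \<Rightarrow> real multiset" where
  "level 0 = {#z0#}"
| "level (Suc n) = (\<Sum>w\<in>#level n. add_mset (\<phi> w) (A w))"

text \<open>The members of level \<open>k\<close> that do not arise through \<phi> from the previous
  level; the root counts as generation 0.\<close>

definition born :: "nat \<Rightarrow> real multiset" where
  "born k = (case k of 0 \<Rightarrow> {#z0#} | Suc n \<Rightarrow> (\<Sum>w\<in>#level n. A w))"

lemma level_Suc: "level (Suc n) = image_mset \<phi> (level n) + born (Suc n)"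
proof -
  have "(\<Sum>w\<in>#M. add_mset (\<phi> w) (A w)) = image_mset \<phi> M + (\<Sum>w\<in>#M. A w)" for M
    by (induction M) auto
  then show ?thesis by (simp add: born_def)
qed

text \<open>Every branch of the tree ends in a run of \<phi>; the members are sorted by the
  generation at which that run begins.\<close>

lemma level_eq: "level n = (\<Sum>k\<le>n. image_mset (\<phi> ^^ (n - k)) (born k))"
proof (induction n)
  case (Suc n)
  have "image_mset \<phi> (level n) = (\<Sum>k\<le>n. image_mset (\<phi> ^^ (Suc n - k)) (born k))"
    unfolding Suc.IH image_mset_sum
    by (intro sum.cong refl) (simp add: Suc_diff_le image_mset.compositionality o_def)
  then show ?case unfolding level_Suc by simp
qed (simp add: born_def)

lemma level_subset: "set_mset (level n) \<subseteq> S"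
proof (induction n)
  case (Suc n)
  then show ?case using \<phi>(1) A(1) by fastforce
qed (use z0 in simp)

lemma size_level: "size (level n) = N ^ n"
proof (induction n)
  case (Suc n)
  have "(\<Sum>w\<in>#level n. size (add_mset (\<phi> w) (A w))) = (\<Sum>w\<in>#level n. N)"
  proof (intro arg_cong[where f = sum_mset] image_mset_cong)
    fix w assume "w \<in># level n"
    then show "size (add_mset (\<phi> w) (A w)) = N" using A(2)[of w] level_subset[of n] N by auto
  qed
  moreover have "size (\<Sum>w\<in>#M. g w) = (\<Sum>w\<in>#M. size (g w))" for M and g :: "real \<Rightarrow> real multiset"
    by (induction M) auto
  ultimately show ?case using Suc by simp
qed simp

lemma
  assumes w: "w \<in># born k"
  shows born_subset: "w \<in> S" and born_ge: "w \<noteq> 0 \<Longrightarrow> \<delta> \<le> w"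
proof -
  have "w \<in> S \<and> (w \<noteq> 0 \<longrightarrow> \<delta> \<le> w)"
  proof (cases k)
    case 0
    then show ?thesis using w z0 by (auto simp: born_def)
  next
    case (Suc n)
    then obtain v where "v \<in># level n" "w \<in># A v" using w by (auto simp: born_def)
    then show ?thesis using A(1)[of v] level_subset[of n] by auto
  qed
  then show "w \<in> S" "w \<noteq> 0 \<Longrightarrow> \<delta> \<le> w" by auto
qed

lemma size_born: "size (born k) \<le> N ^ k"
proof (cases k)
  case (Suc n)
  have "size (born k) \<le> size (level k)" unfolding Suc level_Suc by simp
  then show ?thesis by (simp add: size_level)
qed (simp add: born_def)

lemma born_Suc_nonempty: "\<exists>w. w \<in># born (Suc n)"
proof -
  have "size (level n) > 0" using N by (simp add: size_level)
  then obtain v where v: "v \<in># level n" by (metis size_empty less_numeral_extra(3) multiset_nonemptyE)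
  then have "size (A v) > 0" using A(2)[of v] level_subset[of n] N by auto
  then obtain w where "w \<in># A v" by (metis size_empty less_numeral_extra(3) multiset_nonemptyE)
  with v show ?thesis by (auto simp: born_def)
qed

text \<open>Only generation 0 can contain 0, namely when \<open>z0 = 0\<close>.\<close>

definition born' :: "nat \<Rightarrow> real multiset" where "born' k = filter_mset (\<lambda>w. w \<noteq> 0) (born k)"

lemma born'D: "w \<in># born' k \<Longrightarrow> w \<in> S \<and> \<delta> \<le> w"
  using born_subset born_ge by (auto simp: born'_def)

lemma size_born': "size (born' k) \<le> N ^ k"
  using size_born[of k] size_filter_mset_lesseq[of "\<lambda>w. w \<noteq> 0" "born k"] unfolding born'_def by linarith

lemma born'_nonempty: "\<exists>w. w \<in># born' (Suc n)"
proof -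
  obtain w where w: "w \<in># born (Suc n)" using born_Suc_nonempty by blast
  then obtain v where "v \<in># level n" "w \<in># A v" by (auto simp: born_def)
  then have "w \<ge> \<delta>" using A(1) level_subset by force
  with w \<delta> show ?thesis by (auto simp: born'_def intro!: exI[of _ w])
qed

section \<open>Dominated convergence of the partial sums\<close>

definition term_val :: "real \<Rightarrow> complex \<Rightarrow> complex" where
  "term_val x s = complex_of_real x powr (- s / 2)"

definition partial :: "nat \<Rightarrow> complex \<Rightarrow> complex" where
  "partial n s = (\<Sum>w\<in>#filter_mset (\<lambda>w. w \<noteq> 0) (level n). term_val (c ^ n * w) s)"

text \<open>What the contribution of generation \<open>k\<close> to \<open>partial n s\<close> tends
  to as \<open>n\<close> grows.\<close>

definition gen_sum :: "nat \<Rightarrow> complex \<Rightarrow> complex" where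
  "gen_sum k s = (\<Sum>w\<in>#born' k. term_val (c ^ k * limval w) s)"

text \<open>Sorting by generation leaves the factor \<open>c ^ k\<close> in front of the scaled
  value. Only the number of \<phi>-steps still depends on \<open>n\<close>, which is the form needed
  for dominated convergence.\<close>

lemma partial_eq:
  "partial n s = (\<Sum>k\<le>n. \<Sum>w\<in>#born' k. term_val (c ^ k * scaled w (n - k)) s)"
proof -
  have 1: "filter_mset (\<lambda>w. w \<noteq> 0) (image_mset (\<phi> ^^ m) (born k)) = image_mset (\<phi> ^^ m) (born' k)" for m k
    unfolding born'_def filter_mset_image_mset o_def
    by (intro arg_cong[where f = "image_mset _"] filter_mset_cong) (auto simp: funpow_\<phi>_eq_0_iff born_subset)
  have 2: "c ^ n * (\<phi> ^^ (n - k)) w = c ^ k * scaled w (n - k)" if "k \<le> n" for k w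
    using that by (simp add: scaled_def power_add[symmetric] mult.assoc[symmetric])
  show ?thesis
    unfolding partial_def level_eq filter_mset_sum image_mset_sum sum_mset_sum_mset 1
    by (intro sum.cong refl) (simp add: image_mset.compositionality o_def 2)
qed

definition abscissa :: real where "abscissa = 2 * ln (real N) / ln c"

text \<open>Origin of the abscissa: it is the \<sigma> at which this ratio, the growth
  \<open>N\<close> of a generation against the decay of its terms, equals 1.\<close>

lemma ratio_less_1:
  assumes "\<sigma> > abscissa"
  shows "real N * c powr (- \<sigma> / 2) < 1"
proof -
  have "2 * ln (real N) < \<sigma> * ln c" using assms c by (simp add: abscissa_def field_simps)
  then have "exp (ln (real N) + - \<sigma> / 2 * ln c) < 1" by simp
  also have "exp (ln (real N) + - \<sigma> / 2 * ln c) = real N * c powr (- \<sigma> / 2)"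
    unfolding exp_add using N c by (simp add: powr_def)
  finally show ?thesis .
qed

lemma abscissa_pos: "abscissa > 0"
  using N c by (simp add: abscissa_def)

text \<open>A bound uniform on the strip \<sigma> \<le> Re s \<le> \<tau>: the power of
  \<open>c > 1\<close> is largest at the left edge, the power of \<delta> \<le> 1 at the right
  edge.\<close>

definition maj :: "real \<Rightarrow> real \<Rightarrow> nat \<Rightarrow> real" where
  "maj \<sigma> \<tau> k = \<delta> powr (- \<tau> / 2) * (real N * c powr (- \<sigma> / 2)) ^ k"

lemma summable_maj: "\<sigma> > abscissa \<Longrightarrow> summable (maj \<sigma> \<tau>)"
  unfolding maj_def using ratio_less_1[of \<sigma>] by (intro summable_mult summable_geometric) auto

lemma norm_term_val_le:
  assumes "\<sigma> \<le> Re s" "Re s \<le> \<tau>" "0 < \<sigma>" "x \<ge> c ^ k * \<delta>"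
  shows "norm (term_val x s) \<le> \<delta> powr (- \<tau> / 2) * (c powr (- \<sigma> / 2)) ^ k"
proof -
  have pos: "0 < c ^ k * \<delta>" using c \<delta> by simp
  then have "norm (term_val x s) = x powr (- Re s / 2)"
    using assms(4) unfolding term_val_def by (subst norm_of_real_powr) auto
  also have "\<dots> \<le> (c ^ k * \<delta>) powr (- Re s / 2)"
    using assms pos by (intro powr_mono2') auto
  also have "\<dots> = (c powr (- Re s / 2)) ^ k * \<delta> powr (- Re s / 2)"
    using c \<delta> by (simp add: powr_mult powr_realpow[symmetric] powr_powr mult.commute)
  also have "\<dots> \<le> (c powr (- \<sigma> / 2)) ^ k * \<delta> powr (- \<tau> / 2)"
    using c \<delta> assms by (intro mult_mono power_mono powr_mono powr_mono') auto
  finally show ?thesis by (simp add: mult.commute)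
qed

text \<open>The function \<open>g\<close> is left open so that one bound serves both the scaled
  values at a finite stage and their limits.\<close>

lemma sum_norm_born'_le:
  assumes "\<sigma> \<le> Re s" "Re s \<le> \<tau>" "0 < \<sigma>" "\<And>w. w \<in># born' k \<Longrightarrow> w \<le> g w"
  shows "(\<Sum>w\<in>#born' k. norm (term_val (c ^ k * g w) s)) \<le> maj \<sigma> \<tau> k"
proof -
  have "(\<Sum>w\<in>#born' k. norm (term_val (c ^ k * g w) s))
      \<le> real (size (born' k)) * (\<delta> powr (- \<tau> / 2) * (c powr (- \<sigma> / 2)) ^ k)"
  proof (rule sum_mset_le_size_times)
    fix w assume "w \<in># born' k"
    then have "\<delta> \<le> g w" using born'D assms(4) by force
    then show "norm (term_val (c ^ k * g w) s) \<le> \<delta> powr (- \<tau> / 2) * (c powr (- \<sigma> / 2)) ^ k"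
      using assms(1-3) c by (intro norm_term_val_le mult_left_mono) auto
  qed
  also have "\<dots> \<le> real (N ^ k) * (\<delta> powr (- \<tau> / 2) * (c powr (- \<sigma> / 2)) ^ k)"
    using size_born'[of k] by (intro mult_right_mono) (auto simp del: of_nat_power)
  finally show ?thesis by (simp add: maj_def power_mult_distrib ac_simps)
qed

lemmas norm_born'_sum_le = order_trans[OF norm_sum_mset sum_norm_born'_le]

lemma gen_sum_le: "\<lbrakk>\<sigma> \<le> Re s; Re s \<le> \<tau>; 0 < \<sigma>\<rbrakk> \<Longrightarrow> norm (gen_sum k s) \<le> maj \<sigma> \<tau> k"
  unfolding gen_sum_def using born'D le_limval by (intro norm_born'_sum_le) auto

text \<open>Tannery's theorem: each generation converges, and the majorant does not depend on
  \<open>n\<close>.\<close>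

lemma partial_tendsto:
  assumes "Re s > abscissa"
  shows "(\<lambda>n. partial n s) \<longlonglongrightarrow> (\<Sum>k. gen_sum k s)"
proof -
  \<comment> \<open>Padding by 0 for \<open>k > n\<close> replaces the growing range of summation by
    a full series.\<close>
  define a where "a k n = (if k \<le> n then \<Sum>w\<in>#born' k. term_val (c ^ k * scaled w (n - k)) s else 0)" for k n
  have s: "Re s > 0" using assms abscissa_pos by simp
  have lim: "(\<lambda>n. a k n) \<longlonglongrightarrow> gen_sum k s" for k
  proof -
    have "(\<lambda>m. \<Sum>w\<in>#born' k. term_val (c ^ k * scaled w m) s) \<longlonglongrightarrow> gen_sum k s"
      unfolding gen_sum_def
    proof (rule tendsto_sum_mset)
      fix w assume "w \<in># born' k"
      then have w: "w \<in> S" "\<delta> \<le> w" using born'D by auto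
      then have "0 < c ^ k * limval w" using \<delta> c le_limval[OF w(1)] by auto
      then have "complex_of_real (c ^ k * limval w) \<notin> \<real>\<^sub>\<le>\<^sub>0"
        by (metis Re_complex_of_real complex_nonpos_Reals_iff linorder_not_less)
      then show "(\<lambda>m. term_val (c ^ k * scaled w m) s) \<longlonglongrightarrow> term_val (c ^ k * limval w) s"
        unfolding term_val_def
        by (intro tendsto_powr_complex tendsto_const tendsto_of_real tendsto_mult scaled_tendsto w)
    qed
    \<comment> \<open>After the shift by \<open>k\<close> the condition \<open>k \<le> n\<close>
      always holds, so the padding disappears.\<close>
    then have "(\<lambda>m. a k (m + k)) \<longlonglongrightarrow> gen_sum k s" by (simp add: a_def)
    then show ?thesis by (rule LIMSEQ_offset)
  qed
  have "norm (a k n) \<le> maj (Re s) (Re s) k" for k n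
  proof (cases "k \<le> n")
    case True
    then show ?thesis
      unfolding a_def using s born'D le_scaled by (auto intro!: norm_born'_sum_le)
  qed (use c N \<delta> in \<open>simp add: a_def maj_def\<close>)
  then have bd: "\<forall>\<^sub>F (k, n) in sequentially \<times>\<^sub>F sequentially. norm (a k n) \<le> maj (Re s) (Re s) k"
    by (intro always_eventually) auto
  have "(\<lambda>n. \<Sum>k. a k n) \<longlonglongrightarrow> (\<Sum>k. gen_sum k s)"
    using tannerys_theorem[OF lim bd summable_maj[OF assms]] by simp
  moreover have "(\<Sum>k. a k n) = partial n s" for n
  proof -
    have "(\<Sum>k. a k n) = (\<Sum>k\<le>n. a k n)" by (rule suminf_finite) (auto simp: a_def)
    then show ?thesis by (simp add: partial_eq a_def)
  qed
  ultimately show ?thesis by simp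
qed

section \<open>Holomorphy of the limit\<close>

lemma gen_sum_holomorphic: "gen_sum k holomorphic_on UNIV"
proof -
  have "(\<lambda>s. complex_of_real x powr (- s / 2)) holomorphic_on UNIV" if "x > 0" for x
    using that by (auto intro!: holomorphic_intros simp: powr_def)
  moreover have "0 < c ^ k * limval w" if "w \<in># born' k" for w
    using that born'D[OF that] le_limval[of w] \<delta> c by auto
  ultimately show ?thesis
    unfolding gen_sum_def[abs_def] term_val_def by (intro holomorphic_on_sum_mset) blast
qed

text \<open>Closed discs in the half plane lie in vertical strips on which \<open>maj\<close> is a
  summable majorant, so the Weierstrass test gives local uniform convergence.\<close>

lemma suminf_gen_sum_holomorphic: "(\<lambda>s. \<Sum>k. gen_sum k s) holomorphic_on {s. Re s > abscissa}"
proof (rule holomorphic_uniform_sequence)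
  show "open {s. Re s > abscissa}" by (rule open_halfspace_Re_gt)
  show "(\<lambda>s. \<Sum>k<n. gen_sum k s) holomorphic_on {s. Re s > abscissa}" for n
    by (intro holomorphic_on_sum holomorphic_on_subset[OF gen_sum_holomorphic]) auto
  fix s assume "s \<in> {s. Re s > abscissa}"
  then have s: "Re s > abscissa" by simp
  \<comment> \<open>Half the distance to the boundary line, so that the closed disc stays inside the
    half plane.\<close>
  define r where "r = (Re s - abscissa) / 2"
  have r: "r > 0" using s by (simp add: r_def)
  have re: "Re s - r \<le> Re z \<and> Re z \<le> Re s + r" if "z \<in> cball s r" for z
    using that abs_Re_le_cmod[of "s - z"] by (auto simp: dist_norm)
  have sr: "Re s - r > abscissa" using s by (simp add: r_def field_simps)
  have "uniform_limit (cball s r) (\<lambda>n z. \<Sum>k<n. gen_sum k z) (\<lambda>z. \<Sum>k. gen_sum k z) sequentially"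
    using re sr abscissa_pos
    by (intro Weierstrass_m_test[OF _ summable_maj[OF sr, of "Re s + r"]] gen_sum_le) auto
  moreover have "cball s r \<subseteq> {s. Re s > abscissa}" using re sr by fastforce
  ultimately show "\<exists>d>0. cball s d \<subseteq> {s. Re s > abscissa} \<and>
      uniform_limit (cball s d) (\<lambda>n z. \<Sum>k<n. gen_sum k z) (\<lambda>z. \<Sum>k. gen_sum k z) sequentially"
    using r by blast
qed

section \<open>Rearrangement into a Dirichlet series\<close>

definition born_list :: "nat \<Rightarrow> real list" where
  "born_list k = (SOME xs. mset xs = born' k)"

lemma mset_born_list: "mset (born_list k) = born' k"
  unfolding born_list_def by (rule someI_ex) (rule ex_mset)

text \<open>Pairs of a generation and a position in it: equal values must remain separate terms of
  the series.\<close>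

definition index :: "(nat \<times> nat) set" where
  "index = (SIGMA k:UNIV. {..<length (born_list k)})"

definition val :: "nat \<times> nat \<Rightarrow> real" where
  "val = (\<lambda>(k, j). c ^ k * limval (born_list k ! j))"

lemma val_ge: "(k, j) \<in> index \<Longrightarrow> c ^ k * \<delta> \<le> val (k, j)"
proof -
  assume "(k, j) \<in> index"
  then have "born_list k ! j \<in># born' k"
    unfolding index_def mset_born_list[symmetric] by auto
  then have "\<delta> \<le> limval (born_list k ! j)" using born'D le_limval by force
  then show ?thesis using c by (simp add: val_def)
qed

lemma val_pos: "x \<in> index \<Longrightarrow> val x > 0"
  using val_ge[of "fst x" "snd x"] c \<delta> by (smt (verit) prod.collapse mult_pos_pos zero_less_power)

lemma infinite_index: "infinite index"
proof -
  have "(Suc n, 0) \<in> index" for n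
    using born'_nonempty[of n] unfolding index_def mset_born_list[symmetric] by (auto simp: length_pos_if_in_set)
  then have "range (\<lambda>n. (Suc n, 0)) \<subseteq> index" by blast
  moreover have "infinite (range (\<lambda>n. (Suc n, 0::nat)))"
    by (rule range_inj_infinite) (simp add: inj_def)
  ultimately show ?thesis by (rule infinite_super)
qed

text \<open>Values in generation \<open>k\<close> are at least \<open>c ^ k * \<delta>\<close>, so a
  bound admits only finitely many generations, each of them finite.\<close>

lemma finite_val_le: "finite {x \<in> index. val x \<le> B}"
proof -
  obtain k0 where k0: "B / \<delta> < c ^ k0" using real_arch_pow[OF c] by blast
  have "k < k0" if "(k, j) \<in> index" "val (k, j) \<le> B" for k j
  proof (rule ccontr)
    assume "\<not> k < k0"
    then have "c ^ k0 \<le> c ^ k" using c by (intro power_increasing) auto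
    then have "B / \<delta> < c ^ k" using k0 by simp
    then have "B < c ^ k * \<delta>" using \<delta> by (simp add: field_simps)
    then show False using val_ge[OF that(1)] that(2) by simp
  qed
  then have "{x \<in> index. val x \<le> B} \<subseteq> (SIGMA k:{..<k0}. {..<length (born_list k)})"
    by (auto simp: index_def)
  then show ?thesis by (rule finite_subset) auto
qed

lemma sum_born_list: "(\<Sum>j<length (born_list k). g (born_list k ! j)) = (\<Sum>w\<in>#born' k. g w)"
  unfolding mset_born_list[symmetric]
  by (simp add: sum_mset_sum_list sum_list_sum_nth atLeast0LessThan flip: mset_map)

text \<open>Absolute convergence over generations and within them gives unconditional summability,
  which licenses any reordering by size.\<close>

lemma has_sum_term_val:
  assumes "Re s > abscissa"
  shows "((\<lambda>x. term_val (val x) s) has_sum (\<Sum>k. gen_sum k s)) index"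
proof -
  have s: "Re s > 0" using assms abscissa_pos by simp
  define F where "F k = (\<Sum>w\<in>#born' k. norm (term_val (c ^ k * limval w) s))" for k
  have F: "0 \<le> F k" "F k \<le> maj (Re s) (Re s) k" "norm (gen_sum k s) \<le> F k" for k
  proof -
    show "F k \<le> maj (Re s) (Re s) k"
      unfolding F_def using s born'D le_limval by (intro sum_norm_born'_le) auto
    show "norm (gen_sum k s) \<le> F k" unfolding F_def gen_sum_def by (rule norm_sum_mset)
    then show "0 \<le> F k" using norm_ge_zero order_trans by blast
  qed
  have "summable F"
    by (rule summable_comparison_test'[OF summable_maj[OF assms]]) (use F in simp)
  then have "F summable_on UNIV" using F(1) by (rule summable_nonneg_imp_summable_on)
  have "(\<lambda>x. norm (term_val (val x) s)) summable_on index"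
    unfolding index_def
  proof (rule summable_on_SigmaI)
    fix k :: nat
    show "((\<lambda>j. norm (term_val (val (k, j)) s)) has_sum F k) {..<length (born_list k)}"
      using sum_born_list[of "\<lambda>w. norm (term_val (c ^ k * limval w) s)" k]
      by (intro has_sum_finiteI) (auto simp: F_def val_def)
  qed (use \<open>F summable_on UNIV\<close> in auto)
  then have "(\<lambda>x. term_val (val x) s) summable_on index" by (rule abs_summable_summable)
  moreover have *: "summable (\<lambda>k. norm (gen_sum k s))"
    by (rule summable_comparison_test'[OF \<open>summable F\<close>]) (use F in simp)
  have "((\<lambda>k. gen_sum k s) has_sum (\<Sum>k. gen_sum k s)) UNIV"
    by (rule norm_summable_imp_has_sum[OF * summable_sums[OF summable_norm_cancel[OF *]]])
  ultimately show ?thesis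
    unfolding index_def
  proof (intro has_sum_SigmaI)
    fix k :: nat
    show "((\<lambda>j. term_val (val (k, j)) s) has_sum gen_sum k s) {..<length (born_list k)}"
      using sum_born_list[of "\<lambda>w. term_val (c ^ k * limval w) s" k]
      by (intro has_sum_finiteI) (auto simp: gen_sum_def val_def)
  qed
qed

text \<open>The \<lambda> are the values listed in increasing order. They are unbounded because
  there are infinitely many and only finitely many lie below any bound.\<close>

lemma ex_incseq_representation:
  obtains lam :: "nat \<Rightarrow> real" where "incseq lam" "\<And>j. lam j > 0" "\<not> bdd_above (range lam)"
    "\<And>s. Re s > abscissa \<Longrightarrow> (\<lambda>j. term_val (lam j) s) sums (\<Sum>k. gen_sum k s)"
proof -
  obtain h where h: "bij_betw h (UNIV :: nat set) index" "incseq (val \<circ> h)"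
    using ex_incseq_enumeration[OF infinite_index finite_val_le] by blast
  show ?thesis
  proof (rule that[of "val \<circ> h"])
    show "(val \<circ> h) j > 0" for j using bij_betw_imp_surj_on[OF h(1)] by (auto intro: val_pos)
    show "\<not> bdd_above (range (val \<circ> h))"
    proof
      assume "bdd_above (range (val \<circ> h))"
      then obtain B where B: "\<And>j. val (h j) \<le> B" by (auto simp: bdd_above_def)
      have "val x \<le> B" if "x \<in> index" for x
        using that B bij_betw_imp_surj_on[OF h(1)] by (metis imageE)
      then have "index \<subseteq> {x \<in> index. val x \<le> B}" by auto
      with finite_val_le infinite_index show False using finite_subset by blast
    qed
    fix s assume "Re s > abscissa"
    then have "((\<lambda>j. term_val (val (h j)) s) has_sum (\<Sum>k. gen_sum k s)) UNIV"
      using has_sum_term_val has_sum_reindex_bij_betw[OF h(1), of "\<lambda>x. term_val (val x) s"] by simp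
    then show "(\<lambda>j. term_val ((val \<circ> h) j) s) sums (\<Sum>k. gen_sum k s)"
      unfolding o_def by (rule has_sum_imp_sums)
  qed (rule h(2))
qed

end

section \<open>The zeta function\<close>

text \<open>The definition composes on the outside; the tree needs \<open>R\<close> on the inside,
  since preimages of order \<open>n + 1\<close> are the \<open>R\<close>-preimages of those of order
  \<open>n\<close>.\<close>

lemma iter_poly_Suc: "iter_poly R (Suc n) = pcompose (iter_poly R n) R"
proof (induction n)
  case (Suc n)
  have "iter_poly R (Suc (Suc n)) = pcompose R (iter_poly R (Suc n))" by (simp add: iter_poly_def)
  also have "\<dots> = pcompose (pcompose R (iter_poly R n)) R" by (simp only: Suc pcompose_assoc)
  finally show ?case by (simp add: iter_poly_def)
qed (simp add: iter_poly_def pcompose_pCons)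

lemma degree_iter_poly: "degree (iter_poly R n) = degree R ^ n"
proof (induction n)
  case (Suc n)
  then show ?case by (simp add: iter_poly_Suc degree_pcompose)
qed (simp add: iter_poly_def)

text \<open>Substituting \<open>R\<close> turns each linear factor \<open>x - w\<close> into
  \<open>R - w\<close>, and root multisets add over products.\<close>

lemma proots_smult_prod_mset_shift:
  fixes R :: "complex poly"
  assumes "degree R > 0" and "l \<noteq> 0"
  shows "proots (pcompose (smult l (\<Prod>w\<in>#W. [:-w, 1:])) R) = (\<Sum>w\<in>#W. proots (R - [:w:]))"
proof -
  have nz: "R - [:w:] \<noteq> 0" for w using assms(1) by auto
  have "proots (pcompose (\<Prod>w\<in>#W. [:-w, 1:]) R) = (\<Sum>w\<in>#W. proots (R - [:w:])) \<and>
      pcompose (\<Prod>w\<in>#W. [:-w, 1:]) R \<noteq> 0"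
  proof (induction W)
    case (add w W)
    have "pcompose [:-w, 1:] R = R - [:w:]" by (simp add: pcompose_pCons)
    with add nz[of w] show ?case by (simp add: pcompose_mult proots_mult del: mult_pCons_left)
  qed (simp add: pcompose_1)
  then show ?thesis using assms(2) by (simp add: pcompose_smult)
qed

lemma preimages_Suc:
  assumes "degree R > 0"
  shows "preimages R (Suc n) z = (\<Sum>w\<in>#preimages R n z. proots (R - [:w:]))"
proof -
  define Q where "Q = iter_poly R n - [:z:]"
  have "degree (iter_poly R n) > 0" using assms by (simp add: degree_iter_poly)
  then have "Q \<noteq> 0" by (auto simp: Q_def)
  have "iter_poly R (Suc n) - [:z:] = pcompose Q R"
    by (simp add: Q_def iter_poly_Suc pcompose_diff)
  also have "\<dots> = pcompose (smult (lead_coeff Q) (\<Prod>w\<in>#proots Q. [:-w, 1:])) R"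
    by (simp only: complex_poly_decompose_multiset)
  finally have "proots (iter_poly R (Suc n) - [:z:]) = (\<Sum>w\<in>#proots Q. proots (R - [:w:]))"
    using proots_smult_prod_mset_shift[OF assms, of "lead_coeff Q" "proots Q"] \<open>Q \<noteq> 0\<close>
    by (simp only: leading_coeff_0_iff not_False_eq_True)
  then show ?thesis by (simp only: preimages_def Q_def)
qed

theorem theorem1:
  fixes R :: "complex poly" and N :: nat and c z0 d :: real
  assumes "degree R = N" and "N \<ge> 2"
    and "poly R 0 = 0"
    and "poly (pderiv R) 0 = of_real c" and "c > 1"
    and "julia_set R \<subseteq> complex_of_real ` {0..}"
    and "d = 2 * ln (real N) / ln c"
    and "z0 \<in> base_interval R"
  shows "(\<forall>s. Re s > d \<longrightarrow> convergent (\<lambda>n. zeta_partial R z0 n s)) \<and>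
         zeta_fun R z0 analytic_on {s. Re s > d} \<and>
         (\<exists>lam :: nat \<Rightarrow> real. incseq lam \<and> (\<forall>j. lam j > 0) \<and> \<not> bdd_above (range lam) \<and>
            (\<forall>s. Re s > d \<longrightarrow>
               (\<lambda>j. complex_of_real (lam j) powr (- s / 2)) sums zeta_fun R z0 s))"
proof -
  obtain p b a a' A B where R: "R = cpoly p" and "full_lap_poly p N b a a' A B"
    and hull: "julia_hull R = {0..b}"
    using full_lap_poly_of_julia[OF assms(1-6)] by metis
  interpret full_lap_poly p N b a a' A B by fact
  have real_map: "real_map R = poly p" by (auto simp: real_map_def R)
  have z0: "z0 \<in> core" using base_interval_eq[OF assms(1) hull real_map] assms(8) by (simp add: core_def)
  have c: "poly (pderiv p) 0 = c"
    using assms(4) poly_cpoly[of "pderiv p" 0] by (simp add: R pderiv_cpoly)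
  \<comment> \<open>The choice for each \<open>w\<close> provides the first-lap branch \<phi> and
    the multiset of the remaining preimages.\<close>
  obtain \<phi> T where split: "\<And>w. w \<in> core \<Longrightarrow>
      proots (cpoly p - [:of_real w:]) = image_mset of_real (add_mset (\<phi> w) (T w)) \<and>
      \<phi> w \<in> lap 0 \<and> poly p (\<phi> w) = w \<and> set_mset (T w) \<subseteq> {node 1..b} \<and> size (T w) = N - 1"
    using proots_split by metis
  obtain \<kappa> K where \<kappa>: "\<kappa> > 1" "K \<ge> 0"
    "\<And>x. x \<in> lap 0 \<Longrightarrow> \<kappa> * x \<le> poly p x"
    "\<And>x. x \<in> lap 0 \<Longrightarrow> poly p x \<le> c * x"
    "\<And>x. x \<in> lap 0 \<Longrightarrow> c * x \<le> (1 + K * x) * poly p x"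
    using first_lap_bounds unfolding c by metis
  \<comment> \<open>At most \<open>node 1\<close> for the later preimages, at most a nonzero
    \<open>z0\<close> for the root of the tree, and at most 1 so that powers of \<delta> decrease in
    the exponent.\<close>
  define \<delta> where "\<delta> = min 1 (min (node 1) (if z0 = 0 then 1 else z0))"
  have \<delta>: "\<delta> > 0" "\<delta> \<le> 1" "\<delta> \<le> node 1" "z0 = 0 \<or> \<delta> \<le> z0"
    using node_1 core_nonneg[OF z0] by (auto simp: \<delta>_def)
  interpret tree: preimage_tree \<phi> T core c \<kappa> K \<delta> z0 N
  proof
    fix w assume w: "w \<in> core"
    have "\<phi> w \<in> {0..b}" using split[OF w] node_1 by (auto simp: lap_def)
    then show "\<phi> w \<in> core" using hull_subset_core by blast
    show "set_mset (T w) \<subseteq> core \<inter> {\<delta>..}"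
      using split[OF w] hull_subset_core node_1 \<delta>(3) by (auto intro!: subsetD[OF hull_subset_core])
    show "\<kappa> * \<phi> w \<le> w" "w \<le> c * \<phi> w" "c * \<phi> w \<le> (1 + K * \<phi> w) * w"
      using \<kappa>(3-5)[of "\<phi> w"] split[OF w] by auto
    show "w \<ge> 0" using w by (rule core_nonneg)
    show "size (T w) = N - 1" using split[OF w] by blast
  qed (fact assms(5) \<kappa>(1,2) \<delta>(1,2,4) assms(2) z0)+
  have deg: "degree R > 0" using assms(1,2) by simp
  \<comment> \<open>The abstract tree produces the actual preimages with their multiplicities; in
    particular all of them are real.\<close>
  have preimages: "preimages R n (of_real z0) = image_mset of_real (tree.level n)" for n
  proof (induction n)
    case 0
    have "iter_poly R 0 - [:of_real z0:] = [:- of_real z0, 1:]" by (simp add: iter_poly_def)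
    then show ?case by (simp add: preimages_def)
  next
    case (Suc n)
    have "preimages R (Suc n) (of_real z0) =
        (\<Sum>w\<in>#tree.level n. proots (R - [:of_real w:]))"
      unfolding preimages_Suc[OF deg] Suc by (simp add: image_mset.compositionality o_def)
    also have "\<dots> = (\<Sum>w\<in>#tree.level n. image_mset of_real (add_mset (\<phi> w) (T w)))"
      using tree.level_subset[of n] split by (intro arg_cong[where f = sum_mset] image_mset_cong) (auto simp: R)
    also have "\<dots> = image_mset of_real (tree.level (Suc n))"
    proof -
      have "(\<Sum>w\<in>#M. image_mset f (g w)) = image_mset f (\<Sum>w\<in>#M. g w)"
        for M :: "real multiset" and f :: "real \<Rightarrow> complex" and g
        by (induction M) auto
      then show ?thesis by (simp only: tree.level.simps)
    qed
    finally show ?case .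
  qed
  have partial: "zeta_partial R z0 n s = tree.partial n s" for n s
    unfolding zeta_partial_def preimages tree.partial_def tree.term_val_def assms(4)
    by (simp add: filter_mset_image_mset image_mset.compositionality o_def)
  have abscissa: "tree.abscissa = d" by (simp add: tree.abscissa_def assms(7))
  have lim: "(\<lambda>n. zeta_partial R z0 n s) \<longlonglongrightarrow> (\<Sum>k. tree.gen_sum k s)" if "Re s > d" for s
    using tree.partial_tendsto[of s] that by (simp add: partial abscissa)
  then have zeta: "zeta_fun R z0 s = (\<Sum>k. tree.gen_sum k s)" if "Re s > d" for s
    using that by (simp add: zeta_fun_def limI)
  have "zeta_fun R z0 holomorphic_on {s. Re s > d}"
    using tree.suminf_gen_sum_holomorphic unfolding abscissa
    by (rule holomorphic_transform) (simp add: zeta)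
  then have analytic: "zeta_fun R z0 analytic_on {s. Re s > d}"
    by (simp add: analytic_on_open open_halfspace_Re_gt)
  have conv: "convergent (\<lambda>n. zeta_partial R z0 n s)" if "Re s > d" for s
    using lim[OF that] by (rule convergentI)
  obtain lam :: "nat \<Rightarrow> real" where lam: "incseq lam" "\<And>j. lam j > 0" "\<not> bdd_above (range lam)"
    "\<And>s. Re s > d \<Longrightarrow> (\<lambda>j. complex_of_real (lam j) powr (- s / 2)) sums zeta_fun R z0 s"
    using tree.ex_incseq_representation zeta unfolding abscissa tree.term_val_def by metis
  show ?thesis
    by (intro conjI exI[of _ lam] allI impI) (rule analytic conv lam; assumption)+
qed

end
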